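(* Let $p,q\in(1,+\infty)$ be conjugate exponents, and let $\phi_n:\mathcal{P}_p(\mathbb{R}^d)\to(-\infty,+\infty]$, $n\in\mathbb{N}$, satisfy: ($\phi_n$1) there exist $A,B>0$ and $\mu_\star\in\mathcal{P}_p(\mathbb{R}^d)$ such that $\phi_n(\cdot)\ge-A-B\,\mathcal{W}_p(\cdot,\mu_\star)^p$ for all $n\in\mathbb{N}$; ($\phi_n$2) if $\sup_n\{\phi_n(\mu_n),\mathcal{W}_p(\mu_n,\mu_\star)\}<+\infty$, then there are $n_k\uparrow+\infty$ and $\mu$ with $\mathcal{W}_p(\mu_{n_k},\mu)\to0$. Suppose that $(\phi_n)_n$ $\Gamma$-converges to $\phi:\mathcal{P}_p(\mathbb{R}^d)\to(-\infty,+\infty]$ in $(\mathcal{P}_p(\mathbb{R}^d),\mathcal{W}_p)$. Then there exists a family $(n_\tau)_{\tau>0}$ in $\mathbb{N}$, $n_\tau\uparrow+\infty$ as $\tau\downarrow0$, such that for all choices $(n(\tau))_{\tau>0}$ with $n(\tau)\in\mathbb{N}$ and $n(\tau)\ge n_\tau$ the following holds: whenever $\nu_\tau,\nu\in\mathcal{P}_p(\mathbb{R}^d)$ satisfy $\lim_{\tau\to0}\mathcal{W}_p(\nu_\tau,\nu)=0$ and $\sup_\tau\phi_{n(\tau)}(\nu_\tau)<+\infty$, then $$\liminf_{\tau\to0}\frac{\phi_{n(\tau)}(\nu_\tau)-\mathcal{Y}^{(p)}_\tau\phi_{n(\tau)}(\nu_\tau)}{\tau}\ \ge\ \frac1q|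\partial^-\phi|^q(\nu).$$
   Context: $\mathcal{P}_p(\mathbb{R}^d)$ is the space of Borel probability measures on $\mathbb{R}^d$ with finite $p$-th moment, endowed with the $p$-Wasserstein distance $\mathcal{W}_p$ (cost $|x-y|^p$, $p$-th root). $\Gamma$-convergence of $\phi_n$ to $\phi$ in $(\mathcal{P}_p(\mathbb{R}^d),\mathcal{W}_p)$ means: $\phi(\mu)\le\liminf_n\phi_n(\mu_n)$ whenever $\mathcal{W}_p(\mu_n,\mu)\to0$, and for every $\mu\in\mathcal{P}_p(\mathbb{R}^d)$ there is a sequence $\bar\mu_n$ with $\mathcal{W}_p(\bar\mu_n,\mu)\to0$ and $\phi_n(\bar\mu_n)\to\phi(\mu)$. $p$-Moreau–Yosida approximation: $\mathcal{Y}^{(p)}_\tau\phi_{n(\tau)}(\mu)=\inf_{\nu\in\mathcal{P}_p(\mathbb{R}^d)}\{\phi_{n(\tau)}(\nu)+\frac1{p\tau^{p-1}}\mathcal{W}_p(\nu,\mu)^p\}$. Slopes: for $\mu\in\{\phi<+\infty\}$, the local slope is $|\partial\phi|(\mu)=\limsup_{\mathcal{W}_p(\nu,\mu)\to0}\frac{(\phi(\mu)-\phi(\nu))^+}{\mathcal{W}_p(\mu,\nu)}$; the relaxed slope is $|\partial^-\phi|(\mu)=\inf\{\liminf_n|\partial\phi|(\mu_n):\mathcal{W}_p(\mu_n,\mu)\to0,\ \sup_n\phi(\mu_n)<+\infty\}$.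
   Formalization: Condition (φ_n2) is required along every subsequence of the functionals (bounded sequences μ_j for φ_{m_j}, m_j strictly increasing), not only for full sequences; with full sequences only, the claim fails, e.g. when only the odd-indexed φ_n are coercive. *)

theory Defs
  imports "HOL-Probability.Probability"
begin

definition P_space :: "real \<Rightarrow> ('a::euclidean_space) measure set" where
  "P_space p = {\<mu>. prob_space \<mu> \<and> sets \<mu> = sets borel \<and> integrable \<mu> (\<lambda>x. norm x powr p)}"

definition couplings ::
    "('a::euclidean_space) measure \<Rightarrow> 'a measure \<Rightarrow> ('a \<times> 'a) measure set" where
  "couplings \<mu> \<nu> = {\<gamma>. sets \<gamma> = sets (borel \<Otimes>\<^sub>M borel) \<and>
     distr \<gamma> borel fst = \<mu> \<and> distr \<gamma> borel snd = \<nu>}"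

(* For \<mu> and \<nu> in P_space p the infimum is finite, so enn2real loses nothing there. *)
definition wasserstein :: "real \<Rightarrow> ('a::euclidean_space) measure \<Rightarrow> 'a measure \<Rightarrow> real" where
  "wasserstein p \<mu> \<nu> =
     enn2real (INF \<gamma>\<in>couplings \<mu> \<nu>. \<integral>\<^sup>+z. ennreal (norm (fst z - snd z) powr p) \<partial>\<gamma>) powr (1 / p)"

definition gamma_converges ::
    "real \<Rightarrow> (nat \<Rightarrow> ('a::euclidean_space) measure \<Rightarrow> ereal) \<Rightarrow> ('a measure \<Rightarrow> ereal) \<Rightarrow> bool" where
  "gamma_converges p \<phi>n \<phi> \<longleftrightarrow>
     (\<forall>\<mu>\<in>P_space p. \<forall>\<mu>s. (\<forall>n. \<mu>s n \<in> P_space p) \<and> (\<lambda>n. wasserstein p (\<mu>s n) \<mu>) \<longlonglongrightarrow> 0 \<longrightarrow>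
        \<phi> \<mu> \<le> liminf (\<lambda>n. \<phi>n n (\<mu>s n))) \<and>
     (\<forall>\<mu>\<in>P_space p. \<exists>\<mu>s. (\<forall>n. \<mu>s n \<in> P_space p) \<and> (\<lambda>n. wasserstein p (\<mu>s n) \<mu>) \<longlonglongrightarrow> 0 \<and>
        (\<lambda>n. \<phi>n n (\<mu>s n)) \<longlonglongrightarrow> \<phi> \<mu>)"

(* Equi-coercivity. The bounded sequences are allowed to run along any subsequence (m j) of the
   indices, the case m = id being that of sequences indexed by all n. Taking only m = id would
   not control the functionals with even index: it would hold as soon as those with odd index
   are coercive, or as soon as a single functional is identically infinite. *)
definition equi_coercive ::
    "real \<Rightarrow> (nat \<Rightarrow> ('a::euclidean_space) measure \<Rightarrow> ereal) \<Rightarrow> 'a measure \<Rightarrow> bool" where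
  "equi_coercive p \<phi>n \<mu>star \<longleftrightarrow>
     (\<forall>(m :: nat \<Rightarrow> nat) \<mu>s. strict_mono m \<and> (\<forall>j. \<mu>s j \<in> P_space p) \<and>
        (SUP j. \<phi>n (m j) (\<mu>s j)) < \<infinity> \<and> (SUP j. ereal (wasserstein p (\<mu>s j) \<mu>star)) < \<infinity> \<longrightarrow>
        (\<exists>k :: nat \<Rightarrow> nat. strict_mono k \<and> (\<exists>\<mu>\<in>P_space p. (\<lambda>i. wasserstein p (\<mu>s (k i)) \<mu>) \<longlonglongrightarrow> 0)))"

definition moreau_yosida ::
    "real \<Rightarrow> real \<Rightarrow> (('a::euclidean_space) measure \<Rightarrow> ereal) \<Rightarrow> 'a measure \<Rightarrow> ereal" where
  "moreau_yosida p \<tau> \<phi> \<mu> =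
     (INF \<nu>\<in>P_space p. \<phi> \<nu> + ereal (1 / (p * \<tau> powr (p - 1)) * wasserstein p \<nu> \<mu> powr p))"

(* The limsup is over \<nu> in P_space p with wasserstein p \<nu> \<mu> tending to 0 through positive
   values, i.e. \<nu> \<noteq> \<mu>. The value is only meaningful for \<phi> \<mu> < \<infinity>. *)
definition local_slope ::
    "real \<Rightarrow> (('a::euclidean_space) measure \<Rightarrow> ereal) \<Rightarrow> 'a measure \<Rightarrow> ereal" where
  "local_slope p \<phi> \<mu> =
     Limsup (inf (filtercomap (\<lambda>\<nu>. wasserstein p \<nu> \<mu>) (at_right 0)) (principal (P_space p)))
       (\<lambda>\<nu>. max 0 (\<phi> \<mu> - \<phi> \<nu>) / ereal (wasserstein p \<mu> \<nu>))"

definition relaxed_slope ::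
    "real \<Rightarrow> (('a::euclidean_space) measure \<Rightarrow> ereal) \<Rightarrow> 'a measure \<Rightarrow> ereal" where
  "relaxed_slope p \<phi> \<mu> =
     Inf {liminf (\<lambda>n. local_slope p \<phi> (\<mu>s n)) | \<mu>s.
       (\<forall>n. \<mu>s n \<in> P_space p) \<and> (\<lambda>n. wasserstein p (\<mu>s n) \<mu>) \<longlonglongrightarrow> 0 \<and> (SUP n. \<phi> (\<mu>s n)) < \<infinity>}"

(* Real powers of extended nonnegative reals, for positive exponents. *)
definition ereal_powr :: "ereal \<Rightarrow> real \<Rightarrow> ereal" where
  "ereal_powr x q = (if x = \<infinity> then \<infinity> else ereal (real_of_ereal x powr q))"

end

theory Submission
  imports Defs
begin

text \<open>
  Minimizers \<open>\<sigma>\<^sub>r\<close> of \<open>\<phi> + W(\<cdot>, \<nu>)\<^sup>p / (p r\<^sup>p\<^sup>-\<^sup>1)\<close> have local slope at most \<open>(W(\<sigma>\<^sub>r, \<nu>) / r)\<^sup>p\<^sup>-\<^sup>1\<close>, while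
  the Moreau-Yosida approximation decreases in \<open>r\<close> at rate at least \<open>(1/q) (W(\<sigma>\<^sub>r, \<nu>) / r)\<^sup>p\<close>. Hence a
  lower bound \<open>c\<close> on the slopes near \<open>\<nu>\<close> makes \<open>\<phi>(\<nu>)\<close> exceed its approximation at scale \<open>a\<close> by at
  least \<open>a c\<^sup>q / q\<close>. To pass from \<open>\<phi>\<close> to \<open>\<phi>n\<close>, compactness makes the Gamma-convergence uniform on bounded
  sublevels with an error \<open>a\<^sup>2\<close>, negligible against \<open>a\<close>, as soon as \<open>n\<close> is large; monotonicity in the
  scale allows restricting to the countably many scales \<open>a = 1 / (j + 1)\<close>.

  The triangle inequality for the Wasserstein distance needs no disintegration: two couplings are
  glued along a countable partition of the middle space into cells of small diameter, with an error
  controlled by that diameter.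
\<close>

section \<open>The Wasserstein distance as a metric\<close>

lemma powr_above_tangent:
  fixes p x m :: real
  assumes "1 \<le> p" "0 \<le> x" "0 < m"
  shows "m powr p + p * m powr (p - 1) * (x - m) \<le> x powr p"
proof (cases "x = 0")
  \<comment> \<open>Convexity is used on the open half-line, so the endpoint 0 is checked by
    hand.\<close>
  case True
  have "m powr p = m powr (p-1) * m" using assms by (simp add: powr_diff)
  then have "m powr p + p * m powr (p - 1) * (x - m) = (1-p) * m powr p"
    using True by (simp add: algebra_simps)
  also have "\<dots> \<le> 0" using assms by (simp add: mult_nonpos_nonneg)
  finally show ?thesis using True assms by simp
next
  case False
  have "((\<lambda>x. x powr p) has_field_derivative (p * m powr (p - 1))) (at m within {0<..})"
    using assms by (auto intro!: derivative_eq_intros)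
  from convex_on_imp_above_tangent[OF powr_convex[OF assms(1)] _ _ _ this, of x] False assms
  show ?thesis by (auto simp: interior_open)
qed

text \<open>Jensen's inequality with weights proportional to \<open>F\<close>, \<open>G\<close>,
  \<open>H\<close>. If \<open>a powr p\<close>, \<open>b powr p\<close>, \<open>c powr p\<close>
  have integrals at most \<open>F powr p\<close>, \<open>G powr p\<close>, \<open>H powr p\<close>
  against a measure, integrating the right-hand side gives at most
  \<open>(F + G + H) powr p\<close>: Minkowski's inequality in a form linear in the
  \<open>p\<close>-th powers.\<close>

lemma powr_minkowski_weighted:
  fixes p a b c F G H :: real
  assumes "1 \<le> p" "0 \<le> a" "0 \<le> b" "0 \<le> c" "0 < F" "0 < G" "0 < H"
  shows "(a + b + c) powr p \<le> (F + G + H) powr (p - 1) *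
    (F powr (1 - p) * a powr p + G powr (1 - p) * b powr p + H powr (1 - p) * c powr p)"
proof (cases "a + b + c = 0")
  case True
  then show ?thesis by simp
next
  case False
  define T m where "T = F + G + H" and "m = a + b + c"
  have T: "T > 0" and m: "m > 0" using assms False by (auto simp: T_def m_def)
  have *: "K * (m powr p + p * m powr (p - 1) * (x * T / K - m)) \<le> T powr p * (K powr (1 - p) * x powr p)"
    if "K > 0" "x \<ge> 0" for K x
  proof -
    have "m powr p + p * m powr (p - 1) * (x * T / K - m) \<le> (x * T / K) powr p"
      using that T m assms(1) by (intro powr_above_tangent) auto
    then have "K * (m powr p + p * m powr (p - 1) * (x * T / K - m)) \<le> K * (x * T / K) powr p"
      using that by simp
    also have "\<dots> = T powr p * (K powr (1 - p) * x powr p)"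
      using that T by (simp add: powr_divide powr_mult powr_diff)
    finally show ?thesis .
  qed
  \<comment> \<open>The points \<open>a * T / F\<close>, \<open>b * T / G\<close>,
    \<open>c * T / H\<close> have weighted mean \<open>m\<close>, so the linear terms of the three
    tangents at \<open>m\<close> cancel.\<close>
  have "T * m powr p = F * (m powr p + p * m powr (p - 1) * (a * T / F - m))
     + G * (m powr p + p * m powr (p - 1) * (b * T / G - m))
     + H * (m powr p + p * m powr (p - 1) * (c * T / H - m))" (is "_ = ?R")
  proof -
    have "K * (u + w * (x * T / K - m)) = K * u + w * (x * T - K * m)" if "K > 0" for K u w x
      using that by (simp add: field_simps)
    then have "?R = (F + G + H) * m powr p + p * m powr (p-1) * ((a + b + c) * T - (F + G + H) * m)"
      using assms by (simp add: algebra_simps)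
    then show ?thesis by (simp add: T_def m_def mult.commute)
  qed
  also have "\<dots> \<le> T powr p * (F powr (1 - p) * a powr p) + T powr p * (G powr (1 - p) * b powr p)
     + T powr p * (H powr (1 - p) * c powr p)"
    using assms by (intro add_mono *) auto
  also have "\<dots> = T * (T powr (p - 1) * (F powr (1 - p) * a powr p + G powr (1 - p) * b powr p + H powr (1 - p) * c powr p))"
    using T by (simp add: powr_diff algebra_simps)
  finally show ?thesis using T by (simp add: T_def m_def)
qed

section \<open>Gluing two couplings along a countable partition\<close>

lemma exists_fine_countable_partition:
  fixes \<delta> :: real
  assumes "0 < \<delta>"
  obtains g :: "'a::euclidean_space \<Rightarrow> nat"
  where "g \<in> borel \<rightarrow>\<^sub>M count_space UNIV" "\<And>x y. g x = g y \<Longrightarrow> dist x y \<le> \<delta>"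
proof -
  obtain D :: "'a set" where D: "countable D" "\<And>X. open X \<Longrightarrow> X \<noteq> {} \<Longrightarrow> \<exists>d\<in>D. d \<in> X"
    using countable_dense_setE by metis
  define e where "e = from_nat_into D"
  \<comment> \<open>The cell of \<open>x\<close> is the index of the first point of a dense sequence
    closer than half of \<open>\<delta>\<close>.\<close>
  define g where "g x = (LEAST i. dist (e i) x < \<delta> / 2)" for x
  have ex: "\<exists>i. dist (e i) x < \<delta> / 2" for x
  proof -
    have "x \<in> ball x (\<delta>/2)" using assms by simp
    then obtain d where "d \<in> D" "d \<in> ball x (\<delta> / 2)" using D(2)[of "ball x (\<delta>/2)"] by (metis empty_iff open_ball)
    then show ?thesis using from_nat_into_surj[OF D(1)] unfolding e_def by (metis dist_commute mem_ball)
  qed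
  have g: "dist (e (g x)) x < \<delta> / 2" for x
    unfolding g_def by (rule LeastI_ex[OF ex])
  show ?thesis
  proof
    show "g \<in> borel \<rightarrow>\<^sub>M count_space UNIV" unfolding g_def by measurable
    show "dist x y \<le> \<delta>" if "g x = g y" for x y
      using g[of x] g[of y] that dist_triangle2[of x y "e (g x)"] by (simp add: dist_commute)
  qed
qed

text \<open>Density, with respect to the product measure, of the coupling that makes the two points
  independent given their common cell, provided that cells have equal mass under both measures. In a
  cell of mass zero the reciprocal is infinite, but this concerns only a null set.\<close>

definition glue_density :: "'a measure \<Rightarrow> ('a \<Rightarrow> nat) \<Rightarrow> ('b \<Rightarrow> nat) \<Rightarrow> 'a \<times> 'b \<Rightarrow> ennreal" where
  "glue_density M g1 g2 =
     (\<lambda>(x, y). if g1 x = g2 y then inverse (emeasure M {u\<in>space M. g1 u = g1 x}) else 0)"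

text \<open>Integrating out the second variable produces the mass of the cell of \<open>x\<close> in
  the second space, which \<open>same\<close> identifies with the mass inverted in the density. So
  the glued measure has first marginal \<open>M1\<close>.\<close>

lemma nn_integral_glued_density:
  fixes g1 :: "'a \<Rightarrow> nat" and g2 :: "'b \<Rightarrow> nat"
  assumes "prob_space M1" "prob_space M2"
    and g1[measurable]: "g1 \<in> M1 \<rightarrow>\<^sub>M count_space UNIV"
    and g2[measurable]: "g2 \<in> M2 \<rightarrow>\<^sub>M count_space UNIV"
    and same: "\<And>i. emeasure M2 {y\<in>space M2. g2 y = i} = emeasure M1 {x\<in>space M1. g1 x = i}"
  defines "h \<equiv> glue_density M1 g1 g2"
  shows "h \<in> borel_measurable (M1 \<Otimes>\<^sub>M M2)"
    and "F \<in> borel_measurable M1 \<Longrightarrow> (\<integral>\<^sup>+z. h z * F (fst z) \<partial>(M1 \<Otimes>\<^sub>M M2)) = (\<integral>\<^sup>+x. F x \<partial>M1)"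
proof -
  interpret M1: prob_space M1 by fact
  interpret M2: prob_space M2 by fact
  define w where "w i = emeasure M1 {x\<in>space M1. g1 x = i}" for i
  have w_meas[measurable]: "(\<lambda>x. inverse (w (g1 x))) \<in> borel_measurable M1" by measurable
  note [measurable] = measurable_compose[OF measurable_fst w_meas]
  have h: "h = (\<lambda>z. if g1 (fst z) = g2 (snd z) then inverse (w (g1 (fst z))) else 0)"
    by (auto simp: h_def glue_density_def w_def fun_eq_iff)
  show hm[measurable]: "h \<in> borel_measurable (M1 \<Otimes>\<^sub>M M2)"
  proof -
    \<comment> \<open>Equality of labels is a countable union over the common label.\<close>
    have "Measurable.pred (M1 \<Otimes>\<^sub>M M2) (\<lambda>z. \<exists>i. g1 (fst z) = i \<and> g2 (snd z) = i)" by measurable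
    moreover have "(\<lambda>z. \<exists>i. g1 (fst z) = i \<and> g2 (snd z) = i) = (\<lambda>z. g1 (fst z) = g2 (snd z))" by auto
    ultimately have [measurable]: "Measurable.pred (M1 \<Otimes>\<^sub>M M2) (\<lambda>z. g1 (fst z) = g2 (snd z))" by simp
    show ?thesis unfolding h by measurable
  qed
  assume F[measurable]: "F \<in> borel_measurable M1"
  \<comment> \<open>Almost no point lies in a cell of mass zero, so the reciprocal may be
    cancelled.\<close>
  have "AE x in M1. \<forall>i. w i = 0 \<longrightarrow> g1 x \<noteq> i"
  proof (subst AE_all_countable, intro allI)
    fix i
    show "AE x in M1. w i = 0 \<longrightarrow> g1 x \<noteq> i"
      by (cases "w i = 0") (auto simp: w_def intro!: AE_I[where N="{x\<in>space M1. g1 x = i}"])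
  qed
  then have ae: "AE x in M1. w (g1 x) \<noteq> 0" by eventually_elim auto
  have "(\<integral>\<^sup>+z. h z * F (fst z) \<partial>(M1 \<Otimes>\<^sub>M M2)) = (\<integral>\<^sup>+x. \<integral>\<^sup>+y. h (x, y) * F x \<partial>M2 \<partial>M1)"
    by (subst M2.nn_integral_fst[symmetric]) auto
  also have "\<dots> = (\<integral>\<^sup>+x. F x \<partial>M1)"
  proof (rule nn_integral_cong_AE, use ae in eventually_elim)
    fix x assume wx: "w (g1 x) \<noteq> 0"
    have fin: "w (g1 x) \<noteq> \<infinity>" unfolding w_def using M1.emeasure_finite by simp
    have "(\<integral>\<^sup>+y. h (x, y) * F x \<partial>M2) = (\<integral>\<^sup>+y. (inverse (w (g1 x)) * F x) * indicator {y\<in>space M2. g2 y = g1 x} y \<partial>M2)"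
      by (intro nn_integral_cong) (auto simp: h indicator_def)
    also have "\<dots> = (inverse (w (g1 x)) * F x) * w (g1 x)"
      by (subst nn_integral_cmult_indicator) (auto simp: same w_def)
    also have "\<dots> = (inverse (w (g1 x)) * w (g1 x)) * F x" by (simp add: mult_ac)
    also have "inverse (w (g1 x)) * w (g1 x) = 1" using wx fin
      by (metis ennreal_inverse_eq_top_iff ennreal_mult_divide_eq ennreal_times_divide infinity_ennreal_def mult.commute mult.right_neutral divide_ennreal_def)
    finally show "(\<integral>\<^sup>+y. h (x, y) * F x \<partial>M2) = F x" by simp
  qed
  finally show "(\<integral>\<^sup>+z. h z * F (fst z) \<partial>(M1 \<Otimes>\<^sub>M M2)) = (\<integral>\<^sup>+x. F x \<partial>M1)" .
qed

text \<open>By \<open>same\<close> the density is symmetric under exchange of the factors, so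
  swapping them reduces this to the first marginal.\<close>

lemma nn_integral_glued_density_snd:
  fixes g1 :: "'a \<Rightarrow> nat" and g2 :: "'b \<Rightarrow> nat"
  assumes M1: "prob_space M1" and M2: "prob_space M2"
    and g1[measurable]: "g1 \<in> M1 \<rightarrow>\<^sub>M count_space UNIV"
    and g2[measurable]: "g2 \<in> M2 \<rightarrow>\<^sub>M count_space UNIV"
    and same: "\<And>i. emeasure M2 {y\<in>space M2. g2 y = i} = emeasure M1 {x\<in>space M1. g1 x = i}"
    and F[measurable]: "F \<in> borel_measurable M2"
  shows "(\<integral>\<^sup>+z. glue_density M1 g1 g2 z * F (snd z) \<partial>(M1 \<Otimes>\<^sub>M M2)) = (\<integral>\<^sup>+y. F y \<partial>M2)"
proof -
  interpret M1: prob_space M1 by fact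
  interpret M2: prob_space M2 by fact
  interpret pair_sigma_finite M2 M1 ..
  note [measurable] = nn_integral_glued_density(1)[OF M1 M2 g1 g2 same]
    nn_integral_glued_density(1)[OF M2 M1 g2 g1 same[symmetric]]
  have "(\<integral>\<^sup>+z. glue_density M1 g1 g2 z * F (snd z) \<partial>(M1 \<Otimes>\<^sub>M M2)) =
     (\<integral>\<^sup>+z. glue_density M2 g2 g1 (snd z, fst z) * F (snd z) \<partial>(M1 \<Otimes>\<^sub>M M2))"
    by (intro nn_integral_cong) (auto simp: glue_density_def same split: prod.splits)
  also have "\<dots> = (\<integral>\<^sup>+z. glue_density M2 g2 g1 z * F (fst z) \<partial>(M2 \<Otimes>\<^sub>M M1))"
    by (subst distr_pair_swap) (auto simp: nn_integral_distr split_beta)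
  also have "\<dots> = (\<integral>\<^sup>+y. F y \<partial>M2)"
    by (rule nn_integral_glued_density(2)[OF M2 M1 g2 g1 same[symmetric] F])
  finally show ?thesis .
qed

lemma couplingsD:
  assumes "\<gamma> \<in> couplings \<mu> \<nu>"
  shows "sets \<gamma> = sets (borel \<Otimes>\<^sub>M borel)" "distr \<gamma> borel fst = \<mu>" "distr \<gamma> borel snd = \<nu>"
    "space \<gamma> = UNIV" "fst \<in> \<gamma> \<rightarrow>\<^sub>M borel" "snd \<in> \<gamma> \<rightarrow>\<^sub>M borel"
proof -
  show *: "sets \<gamma> = sets (borel \<Otimes>\<^sub>M borel)" "distr \<gamma> borel fst = \<mu>" "distr \<gamma> borel snd = \<nu>"
    using assms by (auto simp: couplings_def)
  show "space \<gamma> = UNIV" using sets_eq_imp_space_eq[OF *(1)] by (simp add: space_pair_measure)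
  show "fst \<in> \<gamma> \<rightarrow>\<^sub>M borel" "snd \<in> \<gamma> \<rightarrow>\<^sub>M borel"
    by (simp_all add: measurable_cong_sets[OF *(1) refl])
qed

lemma couplings_prob_space:
  assumes "\<gamma> \<in> couplings \<mu> \<nu>" "prob_space \<mu>"
  shows "prob_space \<gamma>"
  using assms couplingsD[OF assms(1)] prob_space_distrD by metis

text \<open>Gluing by cells keeps both outer marginals exactly and puts the two middle coordinates
  into one cell, hence within \<open>\<delta>\<close> of each other. This gap is the third length in
  the weighted Minkowski inequality.\<close>

lemma couplings_triangle:
  fixes \<mu>1 \<mu>2 \<mu>3 :: "('a::euclidean_space) measure"
  assumes p: "1 \<le> p" and pos: "0 < F" "0 < G" "0 < \<delta>"
    and \<mu>2: "prob_space \<mu>2"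
    and \<gamma>1: "\<gamma>1 \<in> couplings \<mu>1 \<mu>2" and \<gamma>2: "\<gamma>2 \<in> couplings \<mu>2 \<mu>3"
    and F: "(\<integral>\<^sup>+z. ennreal (norm (fst z - snd z) powr p) \<partial>\<gamma>1) \<le> ennreal (F powr p)"
    and G: "(\<integral>\<^sup>+z. ennreal (norm (fst z - snd z) powr p) \<partial>\<gamma>2) \<le> ennreal (G powr p)"
  obtains \<gamma> where "\<gamma> \<in> couplings \<mu>1 \<mu>3"
    "(\<integral>\<^sup>+z. ennreal (norm (fst z - snd z) powr p) \<partial>\<gamma>) \<le> ennreal ((F + G + \<delta>) powr p)"
proof -
  note c1 = couplingsD[OF \<gamma>1] and c2 = couplingsD[OF \<gamma>2]
  note [measurable_cong] = c1(1) c2(1)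
  interpret \<gamma>1: prob_space \<gamma>1
    by (metis \<mu>2 c1(3,6) prob_space_distrD)
  interpret \<gamma>2: prob_space \<gamma>2
    by (rule couplings_prob_space[OF \<gamma>2 \<mu>2])
  obtain g :: "'a \<Rightarrow> nat" where [measurable]: "g \<in> borel \<rightarrow>\<^sub>M count_space UNIV"
    and g: "\<And>x y. g x = g y \<Longrightarrow> dist x y \<le> \<delta>"
    using exists_fine_countable_partition[OF pos(3)] by metis
  define g1 g2 where "g1 = (\<lambda>x::'a\<times>'a. g (snd x))" and "g2 = (\<lambda>x::'a\<times>'a. g (fst x))"
  have [measurable]: "g1 \<in> \<gamma>1 \<rightarrow>\<^sub>M count_space UNIV" "g2 \<in> \<gamma>2 \<rightarrow>\<^sub>M count_space UNIV"
    unfolding g1_def g2_def by measurable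
  \<comment> \<open>Both sides are the \<open>\<mu>2\<close>-mass of a cell, seen through the second
    marginal of \<open>\<gamma>1\<close> and the first marginal of \<open>\<gamma>2\<close>.\<close>
  have same: "emeasure \<gamma>2 {y\<in>space \<gamma>2. g2 y = i} = emeasure \<gamma>1 {x\<in>space \<gamma>1. g1 x = i}" for i
  proof -
    have "emeasure \<gamma>1 {x\<in>space \<gamma>1. g1 x = i} = emeasure (distr \<gamma>1 borel snd) {x. g x = i}"
      by (subst emeasure_distr) (auto simp: g1_def c1 vimage_def)
    also have "\<dots> = emeasure (distr \<gamma>2 borel fst) {x. g x = i}" using c1 c2 by simp
    also have "\<dots> = emeasure \<gamma>2 {y\<in>space \<gamma>2. g2 y = i}"
      by (subst emeasure_distr) (auto simp: g2_def c2 vimage_def)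
    finally show ?thesis by simp
  qed
  define h where "h = glue_density \<gamma>1 g1 g2"
  define M where "M = density (\<gamma>1 \<Otimes>\<^sub>M \<gamma>2) h"
  note glue = \<gamma>1.prob_space_axioms \<gamma>2.prob_space_axioms \<open>g1 \<in> _\<close> \<open>g2 \<in> _\<close> same
  have [measurable]: "h \<in> borel_measurable (\<gamma>1 \<Otimes>\<^sub>M \<gamma>2)"
    unfolding h_def by (rule nn_integral_glued_density(1)[OF glue])
  have I1: "(\<integral>\<^sup>+z. f (fst z) \<partial>M) = (\<integral>\<^sup>+x. f x \<partial>\<gamma>1)" if [measurable]: "f \<in> borel_measurable \<gamma>1" for f
    unfolding M_def using nn_integral_glued_density(2)[OF glue that]
    by (simp add: nn_integral_density flip: h_def)
  have I2: "(\<integral>\<^sup>+z. f (snd z) \<partial>M) = (\<integral>\<^sup>+x. f x \<partial>\<gamma>2)" if [measurable]: "f \<in> borel_measurable \<gamma>2" for f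
    unfolding M_def using nn_integral_glued_density_snd[OF glue that]
    by (simp add: nn_integral_density flip: h_def)
  have ae: "AE z in M. g1 (fst z) = g2 (snd z)"
  proof -
    have "0 < h z \<Longrightarrow> g1 (fst z) = g2 (snd z)" for z
      by (auto simp: h_def glue_density_def split: prod.splits if_splits)
    then show ?thesis unfolding M_def by (subst AE_density) auto
  qed
  have setsM[measurable_cong]: "sets M = sets (\<gamma>1 \<Otimes>\<^sub>M \<gamma>2)" by (simp add: M_def)
  have spaceM: "space M = UNIV" using c1 c2 by (simp add: M_def space_pair_measure)
  define \<gamma> where "\<gamma> = distr M (borel \<Otimes>\<^sub>M borel) (\<lambda>z. (fst (fst z), snd (snd z)))"
  show ?thesis
  proof
    have "distr \<gamma> borel fst = \<mu>1"
    proof (rule measure_eqI)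
      show "sets (distr \<gamma> borel fst) = sets \<mu>1" using c1(2) by auto
      fix A assume "A \<in> sets (distr \<gamma> borel fst)"
      then have [measurable]: "A \<in> sets borel" by simp
      have "emeasure (distr \<gamma> borel fst) A = (\<integral>\<^sup>+z. indicator A (fst (fst z)) \<partial>M)"
        unfolding \<gamma>_def by (simp add: distr_distr comp_def nn_integral_distr flip: nn_integral_indicator)
      also have "\<dots> = (\<integral>\<^sup>+z. indicator A (fst z) \<partial>\<gamma>1)" by (rule I1) simp
      also have "\<dots> = emeasure (distr \<gamma>1 borel fst) A"
        by (simp add: nn_integral_distr flip: nn_integral_indicator)
      finally show "emeasure (distr \<gamma> borel fst) A = emeasure \<mu>1 A" using c1 by simp
    qed
    moreover have "distr \<gamma> borel snd = \<mu>3"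
    proof (rule measure_eqI)
      show "sets (distr \<gamma> borel snd) = sets \<mu>3" using c2(3) by auto
      fix A assume "A \<in> sets (distr \<gamma> borel snd)"
      then have [measurable]: "A \<in> sets borel" by simp
      have "emeasure (distr \<gamma> borel snd) A = (\<integral>\<^sup>+z. indicator A (snd (snd z)) \<partial>M)"
        unfolding \<gamma>_def by (simp add: distr_distr comp_def nn_integral_distr flip: nn_integral_indicator)
      also have "\<dots> = (\<integral>\<^sup>+z. indicator A (snd z) \<partial>\<gamma>2)" by (rule I2) simp
      also have "\<dots> = emeasure (distr \<gamma>2 borel snd) A"
        by (simp add: nn_integral_distr flip: nn_integral_indicator)
      finally show "emeasure (distr \<gamma> borel snd) A = emeasure \<mu>3 A" using c2 by simp
    qed
    ultimately show "\<gamma> \<in> couplings \<mu>1 \<mu>3" by (simp add: couplings_def \<gamma>_def)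
    \<comment> \<open>Coefficients of the weighted inequality when the third weight and the third
      length are both \<open>\<delta>\<close>; \<open>c\<close> integrates to itself because
      \<open>M\<close> has mass 1.\<close>
    define K a b c where "K = (F + G + \<delta>) powr (p - 1)"
      and "a = K * F powr (1 - p)" and "b = K * G powr (1 - p)" and "c = K * \<delta> powr (1 - p) * \<delta> powr p"
    have nn: "a \<ge> 0" "b \<ge> 0" "c \<ge> 0" by (auto simp: a_def b_def c_def K_def)
    have tot: "emeasure M (space M) = 1"
      using I1[of "\<lambda>_. 1"] by (simp add: \<gamma>1.emeasure_space_1)
    have "(\<integral>\<^sup>+z. ennreal (norm (fst z - snd z) powr p) \<partial>\<gamma>) =
        (\<integral>\<^sup>+z. ennreal (norm (fst (fst z) - snd (snd z)) powr p) \<partial>M)"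
      unfolding \<gamma>_def by (subst nn_integral_distr) auto
    also have "\<dots> \<le> (\<integral>\<^sup>+z. ennreal a * ennreal (norm (fst (fst z) - snd (fst z)) powr p)
         + ennreal b * ennreal (norm (fst (snd z) - snd (snd z)) powr p) + ennreal c \<partial>M)"
    proof (rule nn_integral_mono_AE, use ae in eventually_elim)
      fix z :: "('a \<times> 'a) \<times> 'a \<times> 'a"
      assume "g1 (fst z) = g2 (snd z)"
      then have d: "norm (snd (fst z) - fst (snd z)) \<le> \<delta>"
        using g by (auto simp: g1_def g2_def dist_norm)
      have "norm (fst (fst z) - snd (snd z)) \<le>
          norm (fst (fst z) - snd (fst z)) + norm (fst (snd z) - snd (snd z)) + norm (snd (fst z) - fst (snd z))"
        by norm
      then have "norm (fst (fst z) - snd (snd z)) powr p \<le>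
          (norm (fst (fst z) - snd (fst z)) + norm (fst (snd z) - snd (snd z)) + \<delta>) powr p"
        using d p by (intro powr_mono2) auto
      also have "\<dots> \<le> K * (F powr (1 - p) * norm (fst (fst z) - snd (fst z)) powr p
          + G powr (1 - p) * norm (fst (snd z) - snd (snd z)) powr p + \<delta> powr (1 - p) * \<delta> powr p)"
        unfolding K_def using p pos by (intro powr_minkowski_weighted) auto
      also have "\<dots> = a * norm (fst (fst z) - snd (fst z)) powr p
          + b * norm (fst (snd z) - snd (snd z)) powr p + c"
        by (simp add: a_def b_def c_def algebra_simps)
      finally show "ennreal (norm (fst (fst z) - snd (snd z)) powr p) \<le>
          ennreal a * ennreal (norm (fst (fst z) - snd (fst z)) powr p)
         + ennreal b * ennreal (norm (fst (snd z) - snd (snd z)) powr p) + ennreal c"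
        using nn by (simp flip: ennreal_mult ennreal_plus)
    qed
    also have "\<dots> = ennreal a * (\<integral>\<^sup>+z. ennreal (norm (fst z - snd z) powr p) \<partial>\<gamma>1)
         + ennreal b * (\<integral>\<^sup>+z. ennreal (norm (fst z - snd z) powr p) \<partial>\<gamma>2) + ennreal c"
      using I1[of "\<lambda>z. ennreal (norm (fst z - snd z) powr p)"] I2[of "\<lambda>z. ennreal (norm (fst z - snd z) powr p)"]
      by (simp add: nn_integral_add nn_integral_cmult tot)
    also have "\<dots> \<le> ennreal a * ennreal (F powr p) + ennreal b * ennreal (G powr p) + ennreal c"
      using F G by (intro add_mono mult_left_mono) auto
    also have "\<dots> = ennreal (a * F powr p + b * G powr p + c)"
      using nn by (simp flip: ennreal_mult ennreal_plus)
    also have "a * F powr p + b * G powr p + c = K * (F + G + \<delta>)"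
      using pos by (simp add: a_def b_def c_def algebra_simps flip: powr_add)
    also have "\<dots> = (F + G + \<delta>) powr p" using pos by (simp add: K_def powr_diff)
    finally show "(\<integral>\<^sup>+z. ennreal (norm (fst z - snd z) powr p) \<partial>\<gamma>) \<le> ennreal ((F + G + \<delta>) powr p)" .
  qed
qed

section \<open>Finiteness and metric properties of the Wasserstein distance\<close>

lemma wasserstein_nonneg [simp]: "0 \<le> wasserstein p \<mu> \<nu>"
  by (simp add: wasserstein_def)

lemma wasserstein_le:
  assumes "0 < p" "0 \<le> F" "\<gamma> \<in> couplings \<mu> \<nu>"
    and "(\<integral>\<^sup>+z. ennreal (norm (fst z - snd z) powr p) \<partial>\<gamma>) \<le> ennreal (F powr p)"
  shows "wasserstein p \<mu> \<nu> \<le> F"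
proof -
  let ?I = "INF \<gamma>\<in>couplings \<mu> \<nu>. \<integral>\<^sup>+z. ennreal (norm (fst z - snd z) powr p) \<partial>\<gamma>"
  have "?I \<le> ennreal (F powr p)" using assms(3,4) by (meson INF_lower2)
  then have "enn2real ?I \<le> F powr p" by (simp add: enn2real_leI)
  then have "enn2real ?I powr (1 / p) \<le> (F powr p) powr (1 / p)"
    using assms(1) by (intro powr_mono2) auto
  then show ?thesis using assms by (simp add: wasserstein_def powr_powr)
qed

lemma P_spaceD:
  assumes "\<mu> \<in> P_space p"
  shows "prob_space \<mu>" "sets \<mu> = sets borel" "space \<mu> = UNIV"
    "(\<integral>\<^sup>+x. ennreal (norm x powr p) \<partial>\<mu>) < \<infinity>"
proof -
  show *: "prob_space \<mu>" "sets \<mu> = sets borel" using assms by (auto simp: P_space_def)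
  show "space \<mu> = UNIV" using sets_eq_imp_space_eq[OF *(2)] by simp
  show "(\<integral>\<^sup>+x. ennreal (norm x powr p) \<partial>\<mu>) < \<infinity>"
    using assms by (auto simp: P_space_def integrable_iff_bounded)
qed

text \<open>The product measure is a coupling whose cost is controlled by the two
  \<open>p\<close>-th moments. Finiteness matters because \<open>enn2real\<close> would turn an
  infinite infimum into 0.\<close>

lemma couplings_finite_cost:
  assumes p: "0 < p" and \<mu>: "\<mu> \<in> P_space p" and \<nu>: "\<nu> \<in> P_space p"
  shows "(INF \<gamma>\<in>couplings \<mu> \<nu>. \<integral>\<^sup>+z. ennreal (norm (fst z - snd z) powr p) \<partial>\<gamma>) < \<infinity>"
proof -
  interpret \<mu>: prob_space \<mu> using P_spaceD(1)[OF \<mu>] .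
  interpret \<nu>: prob_space \<nu> using P_spaceD(1)[OF \<nu>] .
  interpret pair_sigma_finite \<mu> \<nu> ..
  note [measurable_cong] = P_spaceD(2)[OF \<mu>] P_spaceD(2)[OF \<nu>]
  have "distr (\<mu> \<Otimes>\<^sub>M \<nu>) borel fst = distr (\<mu> \<Otimes>\<^sub>M \<nu>) \<mu> fst"
    by (rule distr_cong) (auto simp: P_spaceD(2)[OF \<mu>])
  also have "\<dots> = \<mu>" by (rule \<nu>.distr_pair_fst)
  finally have fst: "distr (\<mu> \<Otimes>\<^sub>M \<nu>) borel fst = \<mu>" .
  have snd: "distr (\<mu> \<Otimes>\<^sub>M \<nu>) borel snd = \<nu>"
  proof (rule measure_eqI)
    fix A assume A: "A \<in> sets (distr (\<mu> \<Otimes>\<^sub>M \<nu>) borel snd)"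
    have "snd -` A \<inter> space (\<mu> \<Otimes>\<^sub>M \<nu>) = UNIV \<times> A"
      by (auto simp: space_pair_measure P_spaceD(3)[OF \<mu>] P_spaceD(3)[OF \<nu>])
    then show "emeasure (distr (\<mu> \<Otimes>\<^sub>M \<nu>) borel snd) A = emeasure \<nu> A"
      using A \<mu>.emeasure_space_1 P_spaceD(2)[OF \<nu>] P_spaceD(2)[OF \<mu>]
      by (simp add: emeasure_distr \<nu>.emeasure_pair_measure_Times P_spaceD(3)[OF \<mu>])
  qed (use P_spaceD(2)[OF \<nu>] in simp)
  have c: "\<mu> \<Otimes>\<^sub>M \<nu> \<in> couplings \<mu> \<nu>"
    using fst snd P_spaceD(2)[OF \<mu>] P_spaceD(2)[OF \<nu>]
    by (auto simp: couplings_def intro!: sets_pair_measure_cong)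
  have "(\<integral>\<^sup>+z. ennreal (norm (fst z - snd z) powr p) \<partial>(\<mu> \<Otimes>\<^sub>M \<nu>)) \<le>
     (\<integral>\<^sup>+z. ennreal (2 powr p) * ennreal (norm (fst z) powr p) + ennreal (2 powr p) * ennreal (norm (snd z) powr p) \<partial>(\<mu> \<Otimes>\<^sub>M \<nu>))"
  proof (rule nn_integral_mono)
    fix z :: "'a \<times> 'a"
    have "norm (fst z - snd z) \<le> norm (fst z) + norm (snd z)" by norm
    also have "\<dots> \<le> 2 * max (norm (fst z)) (norm (snd z))" by simp
    finally have "norm (fst z - snd z) powr p \<le> (2 * max (norm (fst z)) (norm (snd z))) powr p"
      using p by (intro powr_mono2) auto
    also have "\<dots> \<le> 2 powr p * norm (fst z) powr p + 2 powr p * norm (snd z) powr p"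
      by (auto simp: powr_mult max_def)
    finally show "ennreal (norm (fst z - snd z) powr p) \<le>
      ennreal (2 powr p) * ennreal (norm (fst z) powr p) + ennreal (2 powr p) * ennreal (norm (snd z) powr p)"
      by (simp flip: ennreal_mult ennreal_plus)
  qed
  also have "\<dots> = ennreal (2 powr p) * (\<integral>\<^sup>+z. ennreal (norm (fst z) powr p) \<partial>(\<mu> \<Otimes>\<^sub>M \<nu>))
     + ennreal (2 powr p) * (\<integral>\<^sup>+z. ennreal (norm (snd z) powr p) \<partial>(\<mu> \<Otimes>\<^sub>M \<nu>))"
    by (simp add: nn_integral_add nn_integral_cmult)
  also have "(\<integral>\<^sup>+z. ennreal (norm (fst z) powr p) \<partial>(\<mu> \<Otimes>\<^sub>M \<nu>)) = (\<integral>\<^sup>+x. ennreal (norm x powr p) \<partial>\<mu>)"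
    by (subst (2) fst[symmetric]) (simp add: nn_integral_distr)
  also have "(\<integral>\<^sup>+z. ennreal (norm (snd z) powr p) \<partial>(\<mu> \<Otimes>\<^sub>M \<nu>)) = (\<integral>\<^sup>+x. ennreal (norm x powr p) \<partial>\<nu>)"
    by (subst (2) snd[symmetric]) (simp add: nn_integral_distr)
  also have "ennreal (2 powr p) * (\<integral>\<^sup>+x. ennreal (norm x powr p) \<partial>\<mu>)
     + ennreal (2 powr p) * (\<integral>\<^sup>+x. ennreal (norm x powr p) \<partial>\<nu>) < \<infinity>"
    using P_spaceD(4)[OF \<mu>] P_spaceD(4)[OF \<nu>] by (simp add: ennreal_mult_less_top)
  finally show ?thesis using c by (meson INF_lower order_le_less_trans)
qed

lemma wasserstein_less_imp_coupling:
  assumes p: "0 < p" and "\<mu> \<in> P_space p" "\<nu> \<in> P_space p" and less: "wasserstein p \<mu> \<nu> < F"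
  obtains \<gamma> where "\<gamma> \<in> couplings \<mu> \<nu>"
    "(\<integral>\<^sup>+z. ennreal (norm (fst z - snd z) powr p) \<partial>\<gamma>) \<le> ennreal (F powr p)"
proof -
  let ?I = "INF \<gamma>\<in>couplings \<mu> \<nu>. \<integral>\<^sup>+z. ennreal (norm (fst z - snd z) powr p) \<partial>\<gamma>"
  have fin: "?I < top" using couplings_finite_cost[OF assms(1-3)] by simp
  have "(enn2real ?I powr (1 / p)) powr p < F powr p"
    using less p by (intro powr_less_mono2) (auto simp: wasserstein_def)
  then have "enn2real ?I < F powr p" using p by (simp add: powr_powr)
  then have "?I < ennreal (F powr p)"
    by (subst ennreal_enn2real[OF fin, symmetric]) (simp add: ennreal_less_iff)
  then show ?thesis using that by (auto simp: INF_less_iff intro: less_imp_le)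
qed

lemma wasserstein_self [simp]:
  assumes "0 < p" "\<mu> \<in> P_space p"
  shows "wasserstein p \<mu> \<mu> = 0"
proof -
  note [measurable_cong] = P_spaceD(2)[OF assms(2)]
  let ?\<gamma> = "distr \<mu> (borel \<Otimes>\<^sub>M borel) (\<lambda>x. (x, x))"
  have "distr \<mu> borel (\<lambda>x. x) = \<mu>"
    using P_spaceD(2)[OF assms(2)] by (intro distr_id2) simp
  then have "?\<gamma> \<in> couplings \<mu> \<mu>"
    by (simp add: couplings_def distr_distr comp_def)
  then have "wasserstein p \<mu> \<mu> \<le> 0"
    using assms by (intro wasserstein_le) (auto simp: nn_integral_distr)
  then show ?thesis by (simp add: order_antisym)
qed

lemma wasserstein_commute_le:
  assumes "0 < p" "\<mu> \<in> P_space p" "\<nu> \<in> P_space p"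
  shows "wasserstein p \<nu> \<mu> \<le> wasserstein p \<mu> \<nu>"
proof (rule dense_ge)
  fix F assume F: "wasserstein p \<mu> \<nu> < F"
  obtain \<gamma> where \<gamma>: "\<gamma> \<in> couplings \<mu> \<nu>"
    "(\<integral>\<^sup>+z. ennreal (norm (fst z - snd z) powr p) \<partial>\<gamma>) \<le> ennreal (F powr p)"
    by (rule wasserstein_less_imp_coupling[OF assms F])
  note [measurable_cong] = couplingsD(1)[OF \<gamma>(1)]
  note [measurable] = couplingsD(5,6)[OF \<gamma>(1)]
  let ?\<gamma> = "distr \<gamma> (borel \<Otimes>\<^sub>M borel) (\<lambda>x. (snd x, fst x))"
  have "?\<gamma> \<in> couplings \<nu> \<mu>"
    using couplingsD(2,3)[OF \<gamma>(1)] by (simp add: couplings_def distr_distr comp_def)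
  moreover have "0 \<le> F" using F wasserstein_nonneg[of p \<mu> \<nu>] by linarith
  moreover have "(\<integral>\<^sup>+z. ennreal (norm (fst z - snd z) powr p) \<partial>?\<gamma>) \<le> ennreal (F powr p)"
    using \<gamma>(2) by (simp add: nn_integral_distr norm_minus_commute)
  ultimately show "wasserstein p \<nu> \<mu> \<le> F" using assms by (intro wasserstein_le) auto
qed

lemma wasserstein_commute:
  assumes "0 < p" "\<mu> \<in> P_space p" "\<nu> \<in> P_space p"
  shows "wasserstein p \<mu> \<nu> = wasserstein p \<nu> \<mu>"
  using assms by (intro order_antisym wasserstein_commute_le)

lemma wasserstein_triangle:
  assumes p: "1 \<le> p" and "\<mu>1 \<in> P_space p" "\<mu>2 \<in> P_space p" "\<mu>3 \<in> P_space p"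
  shows "wasserstein p \<mu>1 \<mu>3 \<le> wasserstein p \<mu>1 \<mu>2 + wasserstein p \<mu>2 \<mu>3"
proof (rule field_le_epsilon)
  fix e :: real assume "0 < e"
  \<comment> \<open>The slack is spent in thirds: twice to find couplings below \<open>F\<close> and
    \<open>G\<close>, once as the cell diameter. It also makes \<open>F\<close> and \<open>G\<close>
    positive, as they serve as weights.\<close>
  define F G where "F = wasserstein p \<mu>1 \<mu>2 + e / 3" and "G = wasserstein p \<mu>2 \<mu>3 + e / 3"
  have pos: "F > 0" "G > 0" "e / 3 > 0" using \<open>0 < e\<close> by (auto simp: F_def G_def add_nonneg_pos)
  have p0: "0 < p" using p by simp
  have less: "wasserstein p \<mu>1 \<mu>2 < F" "wasserstein p \<mu>2 \<mu>3 < G"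
    using \<open>0 < e\<close> by (auto simp: F_def G_def)
  obtain \<gamma>1 where \<gamma>1: "\<gamma>1 \<in> couplings \<mu>1 \<mu>2"
    "(\<integral>\<^sup>+z. ennreal (norm (fst z - snd z) powr p) \<partial>\<gamma>1) \<le> ennreal (F powr p)"
    by (rule wasserstein_less_imp_coupling[OF p0 assms(2,3) less(1)])
  obtain \<gamma>2 where \<gamma>2: "\<gamma>2 \<in> couplings \<mu>2 \<mu>3"
    "(\<integral>\<^sup>+z. ennreal (norm (fst z - snd z) powr p) \<partial>\<gamma>2) \<le> ennreal (G powr p)"
    by (rule wasserstein_less_imp_coupling[OF p0 assms(3,4) less(2)])
  obtain \<gamma> where "\<gamma> \<in> couplings \<mu>1 \<mu>3"
    "(\<integral>\<^sup>+z. ennreal (norm (fst z - snd z) powr p) \<partial>\<gamma>) \<le> ennreal ((F + G + e / 3) powr p)"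
    using couplings_triangle[OF p pos P_spaceD(1)[OF assms(3)] \<gamma>1(1) \<gamma>2(1) \<gamma>1(2) \<gamma>2(2)] .
  then have "wasserstein p \<mu>1 \<mu>3 \<le> F + G + e / 3" using p pos by (intro wasserstein_le) auto
  then show "wasserstein p \<mu>1 \<mu>3 \<le> wasserstein p \<mu>1 \<mu>2 + wasserstein p \<mu>2 \<mu>3 + e"
    by (simp add: F_def G_def)
qed

lemma tendsto_wasserstein:
  assumes p: "1 \<le> p" and P: "\<And>i. \<mu>s i \<in> P_space p" "\<And>i. \<nu>s i \<in> P_space p" "\<mu> \<in> P_space p" "\<nu> \<in> P_space p"
    and lim: "((\<lambda>i. wasserstein p (\<mu>s i) \<mu>) \<longlongrightarrow> 0) X" "((\<lambda>i. wasserstein p (\<nu>s i) \<nu>) \<longlongrightarrow> 0) X"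
  shows "((\<lambda>i. wasserstein p (\<mu>s i) (\<nu>s i)) \<longlongrightarrow> wasserstein p \<mu> \<nu>) X"
proof (rule LIM_zero_cancel, rule Lim_null_comparison)
  show "\<forall>\<^sub>F i in X. norm (wasserstein p (\<mu>s i) (\<nu>s i) - wasserstein p \<mu> \<nu>)
      \<le> wasserstein p (\<mu>s i) \<mu> + wasserstein p (\<nu>s i) \<nu>"
  proof (rule always_eventually, intro allI)
    fix i
    have p0: "0 < p" using p by simp
    note t = wasserstein_triangle[OF p] and c = wasserstein_commute[OF p0]
    show "norm (wasserstein p (\<mu>s i) (\<nu>s i) - wasserstein p \<mu> \<nu>)
      \<le> wasserstein p (\<mu>s i) \<mu> + wasserstein p (\<nu>s i) \<nu>"
      using t[OF P(1)[of i] P(3) P(2)[of i]] t[OF P(3) P(4) P(2)[of i]] t[OF P(3) P(1)[of i] P(4)]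
        t[OF P(1)[of i] P(2)[of i] P(4)] c[OF P(3) P(1)[of i]] c[OF P(4) P(2)[of i]]
      by simp
  qed
  show "((\<lambda>i. wasserstein p (\<mu>s i) \<mu> + wasserstein p (\<nu>s i) \<nu>) \<longlongrightarrow> 0) X"
    using tendsto_add[OF lim] by simp
qed

section \<open>Moreau-Yosida approximations of Gamma-limits\<close>

text \<open>The tangent inequality at \<open>s\<close> for the convex function
  \<open>x powr (1 - p)\<close>, multiplied by \<open>r powr p\<close>. It measures how much the
  penalty weight drops between two scales.\<close>

lemma powr_decrease_ge:
  fixes p r s :: real
  assumes "1 < p" "0 < r" "r < s"
  shows "(p - 1) * (r / s) powr p * (s - r) \<le> r powr p * (r powr (1 - p) - s powr (1 - p))"
proof -
  have ln: "1 - r / s \<le> ln (s / r)"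
    using assms ln_le_minus_one[of "r / s"] by (simp add: ln_div)
  have "1 + (p - 1) * (1 - r / s) \<le> 1 + (p - 1) * ln (s / r)"
    using ln assms by simp
  also have "\<dots> \<le> exp ((p - 1) * ln (s / r))" by (rule exp_ge_add_one_self)
  also have "\<dots> = (s / r) powr (p - 1)" using assms by (simp add: powr_def)
  finally have *: "(p - 1) * (1 - r / s) \<le> (s / r) powr (p - 1) - 1" by simp
  have "(p - 1) * (r / s) powr p * (s - r) = s powr (1 - p) * r powr p * ((p - 1) * (1 - r / s))"
    using assms by (simp add: powr_divide powr_diff field_simps)
  also have "\<dots> \<le> s powr (1 - p) * r powr p * ((s / r) powr (p - 1) - 1)"
    using * by (intro mult_left_mono) auto
  also have "\<dots> = r powr p * (r powr (1 - p) - s powr (1 - p))"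
    using assms by (simp add: powr_divide powr_diff field_simps)
  finally show ?thesis .
qed

text \<open>The one-sided difference quotients of \<open>f\<close> are controlled only up to the factor \<open>(r / s) powr p\<close>;
  a geometric partition with ratio close to 1 makes this factor harmless.\<close>

lemma geometric_partition_descent:
  fixes f :: "real \<Rightarrow> real"
  assumes a: "0 < a" and K: "0 \<le> K"
    and step: "\<And>r s. 0 < r \<Longrightarrow> r < s \<Longrightarrow> s \<le> a \<Longrightarrow> K * (r / s) powr p * (s - r) \<le> f r - f s"
    and M: "\<And>r. 0 < r \<Longrightarrow> r \<le> a \<Longrightarrow> f r \<le> M"
  shows "K * a \<le> M - f a"
proof -
  have 1: "K * l powr p * a \<le> M - f a" if l: "0 < l" "l < 1" for l
  proof -
    \<comment> \<open>Neighbouring points \<open>l ^ i * a\<close> all have ratio \<open>l\<close>,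
      so each step carries the same factor \<open>l powr p\<close> and the lengths
      telescope.\<close>
    have ind: "K * l powr p * (1 - l ^ i) * a \<le> f (l ^ i * a) - f a" for i
    proof (induction i)
      case (Suc i)
      have "l ^ Suc i * a < l ^ i * a" "l ^ i * a \<le> a"
        using l a by (auto simp: power_le_one mult_le_cancel_right1)
      then have "K * (l ^ Suc i * a / (l ^ i * a)) powr p * (l ^ i * a - l ^ Suc i * a)
          \<le> f (l ^ Suc i * a) - f (l ^ i * a)"
        using l a by (intro step) auto
      moreover have "l ^ Suc i * a / (l ^ i * a) = l" using l a by simp
      ultimately show ?case using Suc by (simp add: algebra_simps)
    qed simp
    have "K * l powr p * (1 - l ^ i) * a \<le> M - f a" for i
    proof -
      have "f (l ^ i * a) \<le> M" using l a by (intro M) (auto simp: power_le_one mult_le_cancel_right1)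
      then show ?thesis using ind[of i] by linarith
    qed
    \<comment> \<open>At fixed ratio \<open>l\<close> the partition first exhausts the interval down
      to 0; only afterwards does \<open>l\<close> tend to 1.\<close>
    moreover have "(\<lambda>i. K * l powr p * (1 - l ^ i) * a) \<longlonglongrightarrow> K * l powr p * (1 - 0) * a"
      using l by (intro tendsto_intros LIMSEQ_realpow_zero) auto
    ultimately have "K * l powr p * (1 - 0) * a \<le> M - f a" by (intro LIMSEQ_le_const2) auto
    then show ?thesis by simp
  qed
  have "((\<lambda>l. K * l powr p * a) \<longlongrightarrow> K * 1 powr p * a) (at_left 1)"
    by (intro tendsto_intros) auto
  moreover have "\<forall>\<^sub>F l in at_left 1. K * l powr p * a \<le> M - f a"
    by (rule eventually_mono[OF eventually_at_left_real[of 0 1]]) (use 1 in auto)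
  ultimately have "K * 1 powr p * a \<le> M - f a" by (rule tendsto_upperbound) simp
  then show ?thesis by simp
qed

section \<open>Bounds, compactness and lower semicontinuity inherited by the Gamma-limit\<close>

locale gamma_limit =
  fixes p A B :: real
    and \<phi>n :: "nat \<Rightarrow> ('a::euclidean_space) measure \<Rightarrow> ereal"
    and \<phi> :: "'a measure \<Rightarrow> ereal"
    and \<mu>star :: "'a measure"
  assumes p: "1 < p"
    and \<phi>_proper: "\<And>\<mu>. \<mu> \<in> P_space p \<Longrightarrow> -\<infinity> < \<phi> \<mu>"
    and B: "B > 0"
    and \<mu>star: "\<mu>star \<in> P_space p"
    and \<phi>n_lower_bound:
      "\<And>n \<mu>. \<mu> \<in> P_space p \<Longrightarrow> \<phi>n n \<mu> \<ge> ereal (- A - B * wasserstein p \<mu> \<mu>star powr p)"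
    and coercive: "equi_coercive p \<phi>n \<mu>star"
    and gamma: "gamma_converges p \<phi>n \<phi>"
begin

abbreviation P where "P \<equiv> P_space p :: 'a measure set"
abbreviation W where "W \<equiv> wasserstein p :: 'a measure \<Rightarrow> 'a measure \<Rightarrow> real"

lemma p_pos: "0 < p" "1 \<le> p" using p by auto

lemma W_self [simp]: "\<mu> \<in> P \<Longrightarrow> W \<mu> \<mu> = 0"
  using p by simp

lemmas W_commute = wasserstein_commute[OF p_pos(1)]
  and W_triangle = wasserstein_triangle[OF p_pos(2)]
  and tendsto_W = tendsto_wasserstein[OF p_pos(2)]

lemma tendsto_W_const:
  assumes "\<And>i. \<mu>s i \<in> P" "\<mu> \<in> P" "\<nu> \<in> P" "((\<lambda>i. W (\<mu>s i) \<mu>) \<longlongrightarrow> 0) X"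
  shows "((\<lambda>i. W (\<mu>s i) \<nu>) \<longlongrightarrow> W \<mu> \<nu>) X"
  by (rule tendsto_W) (use assms in auto)

lemma recovery_sequence:
  assumes "\<mu> \<in> P"
  obtains \<mu>s where "\<And>n. \<mu>s n \<in> P" "(\<lambda>n. W (\<mu>s n) \<mu>) \<longlonglongrightarrow> 0" "(\<lambda>n. \<phi>n n (\<mu>s n)) \<longlonglongrightarrow> \<phi> \<mu>"
  using gamma assms unfolding gamma_converges_def by blast

text \<open>The bound passes to the limit along a recovery sequence, since the distance to
  \<open>\<mu>star\<close> is continuous.\<close>

lemma \<phi>_lower_bound:
  assumes "\<mu> \<in> P"
  shows "\<phi> \<mu> \<ge> ereal (- A - B * W \<mu> \<mu>star powr p)"
proof -
  obtain \<mu>s where *: "\<And>n. \<mu>s n \<in> P" "(\<lambda>n. W (\<mu>s n) \<mu>) \<longlonglongrightarrow> 0" "(\<lambda>n. \<phi>n n (\<mu>s n)) \<longlonglongrightarrow> \<phi> \<mu>"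
    using recovery_sequence[OF assms] by blast
  have "(\<lambda>n. W (\<mu>s n) \<mu>star) \<longlonglongrightarrow> W \<mu> \<mu>star"
    by (rule tendsto_W_const[OF *(1) assms \<mu>star *(2)])
  then have "(\<lambda>n. ereal (- A - B * W (\<mu>s n) \<mu>star powr p)) \<longlonglongrightarrow> ereal (- A - B * W \<mu> \<mu>star powr p)"
    using p by (intro tendsto_intros tendsto_powr') auto
  from LIMSEQ_le[OF this *(3)] show ?thesis using \<phi>n_lower_bound[OF *(1)] by blast
qed

text \<open>The Gamma-liminf inequality speaks of full sequences. Filling the indices outside the
  range of \<open>m\<close> with \<open>\<mu>\<close> itself keeps the convergence, and passing to a
  subsequence can only raise the liminf.\<close>

lemma gamma_liminf_subseq:
  fixes m :: "nat \<Rightarrow> nat"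
  assumes \<mu>: "\<mu> \<in> P" and m: "strict_mono m" and \<nu>: "\<And>j. \<nu>s j \<in> P" and lim: "(\<lambda>j. W (\<nu>s j) \<mu>) \<longlonglongrightarrow> 0"
  shows "\<phi> \<mu> \<le> liminf (\<lambda>j. \<phi>n (m j) (\<nu>s j))"
proof -
  have inj: "inj m" using m by (simp add: strict_mono_imp_inj_on)
  define \<mu>s where "\<mu>s n = (if n \<in> range m then \<nu>s (inv m n) else \<mu>)" for n
  have \<mu>sm: "\<mu>s (m j) = \<nu>s j" for j by (simp add: \<mu>s_def inj)
  have "(\<lambda>n. W (\<mu>s n) \<mu>) \<longlonglongrightarrow> 0"
  proof (rule LIMSEQ_I)
    fix r :: real assume "0 < r"
    then obtain N where N: "\<And>j. j \<ge> N \<Longrightarrow> W (\<nu>s j) \<mu> < r"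
      using LIMSEQ_D[OF lim] by fastforce
    have "W (\<mu>s n) \<mu> < r" if "n \<ge> m N" for n
    proof (cases "n \<in> range m")
      case True
      then obtain j where j: "n = m j" by blast
      then have "j \<ge> N" using that m by (simp add: strict_mono_less_eq)
      then show ?thesis using N j \<mu>sm by simp
    qed (use \<mu> \<open>0 < r\<close> in \<open>auto simp: \<mu>s_def\<close>)
    then show "\<exists>no. \<forall>n\<ge>no. norm (W (\<mu>s n) \<mu> - 0) < r" by auto
  qed
  moreover have "\<mu>s n \<in> P" for n by (simp add: \<mu>s_def \<mu> \<nu>)
  ultimately have "\<phi> \<mu> \<le> liminf (\<lambda>n. \<phi>n n (\<mu>s n))"
    using gamma \<mu> unfolding gamma_converges_def by blast
  also have "\<dots> \<le> liminf ((\<lambda>n. \<phi>n n (\<mu>s n)) \<circ> m)" by (rule liminf_subseq_mono[OF m])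
  also have "(\<lambda>n. \<phi>n n (\<mu>s n)) \<circ> m = (\<lambda>j. \<phi>n (m j) (\<nu>s j))" by (auto simp: \<mu>sm)
  finally show ?thesis .
qed

lemma equi_coerciveD:
  fixes m :: "nat \<Rightarrow> nat"
  assumes "strict_mono m" "\<And>j. \<nu>s j \<in> P" "\<And>j. \<phi>n (m j) (\<nu>s j) \<le> ereal C" "\<And>j. W (\<nu>s j) \<mu>star \<le> D"
  obtains k \<nu> where "strict_mono k" "\<nu> \<in> P" "(\<lambda>i. W (\<nu>s (k i)) \<nu>) \<longlonglongrightarrow> 0"
proof -
  have "(SUP j. \<phi>n (m j) (\<nu>s j)) \<le> ereal C" using assms(3) by (rule SUP_least)
  then have 1: "(SUP j. \<phi>n (m j) (\<nu>s j)) < \<infinity>" by auto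
  have "(SUP j. ereal (W (\<nu>s j) \<mu>star)) \<le> ereal D" using assms(4) by (intro SUP_least) simp
  then have 2: "(SUP j. ereal (W (\<nu>s j) \<mu>star)) < \<infinity>" by auto
  show ?thesis
    using coercive[unfolded equi_coercive_def, rule_format, of m \<nu>s] assms 1 2 that by blast
qed

text \<open>A diagonal recovery sequence transfers coercivity from \<open>\<phi>n\<close> to \<open>\<phi>\<close> and gives lower semicontinuity.\<close>

lemma \<phi>_compact_lsc:
  fixes e :: "nat \<Rightarrow> real"
  assumes \<sigma>: "\<And>j. \<sigma>s j \<in> P" and e: "\<And>j. \<phi> (\<sigma>s j) \<le> ereal (e j)"
    and C: "\<And>j. e j \<le> C" and D: "\<And>j. W (\<sigma>s j) \<mu>star \<le> D"
  obtains k \<sigma> where "strict_mono k" "\<sigma> \<in> P" "(\<lambda>i. W (\<sigma>s (k i)) \<sigma>) \<longlonglongrightarrow> 0"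
    "\<And>L. (\<lambda>i. e (k i)) \<longlonglongrightarrow> L \<Longrightarrow> \<phi> \<sigma> \<le> ereal L"
proof -
  \<comment> \<open>Along a recovery sequence for \<open>\<sigma>s j\<close> both errors get small
    at indices beyond any \<open>N\<close>; the freedom in \<open>N\<close> lets the diagonal choice
    have strictly increasing indices.\<close>
  have ex: "\<exists>n\<ge>N. \<exists>\<rho>\<in>P. W \<rho> (\<sigma>s j) \<le> 1 / real (Suc j) \<and> \<phi>n n \<rho> \<le> ereal (e j + 1 / real (Suc j))" for j N
  proof -
    obtain \<mu>s where *: "\<And>n. \<mu>s n \<in> P" "(\<lambda>n. W (\<mu>s n) (\<sigma>s j)) \<longlonglongrightarrow> 0" "(\<lambda>n. \<phi>n n (\<mu>s n)) \<longlonglongrightarrow> \<phi> (\<sigma>s j)"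
      using recovery_sequence[OF \<sigma>] by blast
    have "\<phi> (\<sigma>s j) < ereal (e j + 1 / real (Suc j))"
      using e[of j] by (rule order_le_less_trans) simp
    note ev1 = order_tendstoD(2)[OF *(3) this]
    have ev2: "\<forall>\<^sub>F n in sequentially. W (\<mu>s n) (\<sigma>s j) < 1 / real (Suc j)"
      by (rule order_tendstoD(2)[OF *(2)]) simp
    from ev1 ev2 eventually_ge_at_top[of N]
    have "\<forall>\<^sub>F n in sequentially. n \<ge> N \<and> W (\<mu>s n) (\<sigma>s j) \<le> 1 / real (Suc j) \<and> \<phi>n n (\<mu>s n) \<le> ereal (e j + 1 / real (Suc j))"
      by eventually_elim (auto simp del: of_nat_Suc)
    then show ?thesis using *(1) eventually_happens' by (metis (no_types, lifting) sequentially_bot)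
  qed
  have "\<exists>x. \<forall>j. (snd (x j) \<in> P \<and> W (snd (x j)) (\<sigma>s j) \<le> 1 / real (Suc j) \<and>
      \<phi>n (fst (x j)) (snd (x j)) \<le> ereal (e j + 1 / real (Suc j))) \<and> fst (x j) < fst (x (Suc j))"
  proof (rule dependent_nat_choice)
    show "\<exists>x. snd x \<in> P \<and> W (snd x) (\<sigma>s 0) \<le> 1 / real (Suc 0) \<and> \<phi>n (fst x) (snd x) \<le> ereal (e 0 + 1 / real (Suc 0))"
      using ex[of 0 0] by auto
    show "\<exists>y. (snd y \<in> P \<and> W (snd y) (\<sigma>s (Suc j)) \<le> 1 / real (Suc (Suc j)) \<and>
       \<phi>n (fst y) (snd y) \<le> ereal (e (Suc j) + 1 / real (Suc (Suc j)))) \<and> fst x < fst y" for x :: "nat \<times> 'a measure" and j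
      using ex[where j="Suc j" and N="Suc (fst x)"] by (auto simp: Suc_le_eq)
  qed
  then obtain x where x: "\<And>j. snd (x j) \<in> P" "\<And>j. W (snd (x j)) (\<sigma>s j) \<le> 1 / real (Suc j)"
      "\<And>j. \<phi>n (fst (x j)) (snd (x j)) \<le> ereal (e j + 1 / real (Suc j))" "\<And>j. fst (x j) < fst (x (Suc j))"
    by blast
  define m \<rho> where "m j = fst (x j)" and "\<rho> j = snd (x j)" for j
  have m: "strict_mono m" using x(4) by (simp add: strict_mono_Suc_iff m_def)
  have le1: "1 / real (Suc j) \<le> 1" for j by simp
  have 1: "\<phi>n (m j) (\<rho> j) \<le> ereal (C + 1)" for j
    using x(3)[of j] unfolding m_def \<rho>_def by (rule order_trans) (use add_mono[OF C[of j] le1[of j]] in \<open>simp del: of_nat_Suc\<close>)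
  have 2: "W (\<rho> j) \<mu>star \<le> D + 1" for j
    using W_triangle[OF x(1)[of j] \<sigma>[of j] \<mu>star] x(2)[of j] D[of j] le1[of j] unfolding \<rho>_def by linarith
  obtain k \<sigma> where k: "strict_mono k" "\<sigma> \<in> P" "(\<lambda>i. W (\<rho> (k i)) \<sigma>) \<longlonglongrightarrow> 0"
    using equi_coerciveD[OF m _ 1 2] x(1) unfolding \<rho>_def by blast
  have inv0: "(\<lambda>i. 1 / real (Suc (k i))) \<longlonglongrightarrow> 0"
    using LIMSEQ_subseq_LIMSEQ[OF LIMSEQ_inverse_real_of_nat k(1)] by (simp add: comp_def inverse_eq_divide)
  show ?thesis
  proof
    show "strict_mono k" "\<sigma> \<in> P" by fact+
    have "W (\<sigma>s (k i)) \<sigma> \<le> 1 / real (Suc (k i)) + W (\<rho> (k i)) \<sigma>" for i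
      using W_triangle[OF \<sigma>[of "k i"] x(1)[of "k i"] k(2)] x(2)[of "k i"] W_commute[OF x(1)[of "k i"] \<sigma>[of "k i"]]
      unfolding \<rho>_def by linarith
    then show "(\<lambda>i. W (\<sigma>s (k i)) \<sigma>) \<longlonglongrightarrow> 0"
      by (intro tendsto_sandwich[OF _ _ tendsto_const tendsto_add_zero[OF inv0 k(3)]]) auto
    \<comment> \<open>The energies \<open>\<phi> (\<sigma>s j)\<close> need not converge, so the
      bound is read off from the limit of their majorants \<open>e\<close>.\<close>
    fix L assume L: "(\<lambda>i. e (k i)) \<longlonglongrightarrow> L"
    have "strict_mono (m \<circ> k)" using m k(1) by (simp add: strict_mono_o)
    from gamma_liminf_subseq[OF k(2) this _ k(3)] x(1)
    have "\<phi> \<sigma> \<le> liminf (\<lambda>i. \<phi>n (m (k i)) (\<rho> (k i)))" by (simp add: \<rho>_def)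
    also have "\<dots> \<le> liminf (\<lambda>i. ereal (e (k i) + 1 / real (Suc (k i))))"
      using x(3) by (intro Liminf_mono always_eventually) (simp add: m_def \<rho>_def)
    also have "\<dots> = ereal L"
      using tendsto_add[OF L inv0] by (intro lim_imp_Liminf) (auto simp del: of_nat_Suc)
    finally show "\<phi> \<sigma> \<le> ereal L" .
  qed
qed

section \<open>Penalized functionals and existence of minimizers\<close>

definition pen :: "real \<Rightarrow> real" where
  "pen r = 1 / (p * r powr (p - 1))"

definition is_min :: "real \<Rightarrow> 'a measure \<Rightarrow> 'a measure \<Rightarrow> bool" where
  "is_min r \<nu> \<sigma> \<longleftrightarrow> (\<forall>\<rho>\<in>P. \<phi> \<sigma> + ereal (pen r * W \<sigma> \<nu> powr p) \<le> \<phi> \<rho> + ereal (pen r * W \<rho> \<nu> powr p))"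

lemma pen_pos: "0 < r \<Longrightarrow> 0 < pen r"
  using p by (simp add: pen_def)

lemma pen_antimono: "0 < r \<Longrightarrow> r \<le> s \<Longrightarrow> pen s \<le> pen r"
  using p unfolding pen_def by (intro divide_left_mono mult_left_mono powr_mono2) auto

lemma moreau_yosida_eq:
  "moreau_yosida p r \<psi> \<nu> = (INF \<rho>\<in>P. \<psi> \<rho> + ereal (pen r * W \<rho> \<nu> powr p))"
  by (simp add: moreau_yosida_def pen_def)

lemma moreau_yosida_le:
  "\<rho> \<in> P \<Longrightarrow> moreau_yosida p r \<psi> \<nu> \<le> \<psi> \<rho> + ereal (pen r * W \<rho> \<nu> powr p)"
  unfolding moreau_yosida_eq by (rule INF_lower)

lemma moreau_yosida_le_self: "\<nu> \<in> P \<Longrightarrow> moreau_yosida p r \<psi> \<nu> \<le> \<psi> \<nu>"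
  using moreau_yosida_le[of \<nu> r \<psi> \<nu>] p by (simp add: zero_ereal_def[symmetric])

lemma moreau_yosida_antimono:
  fixes \<psi> :: "'a measure \<Rightarrow> ereal"
  shows "0 < r \<Longrightarrow> r \<le> s \<Longrightarrow> moreau_yosida p s \<psi> \<nu> \<le> moreau_yosida p r \<psi> \<nu>"
  unfolding moreau_yosida_eq
  by (intro INF_mono bexI add_mono) (auto intro!: mult_right_mono pen_antimono)

lemma moreau_yosida_min:
  assumes "\<sigma> \<in> P" "is_min r \<nu> \<sigma>"
  shows "moreau_yosida p r \<phi> \<nu> = \<phi> \<sigma> + ereal (pen r * W \<sigma> \<nu> powr p)"
  using assms unfolding moreau_yosida_eq is_min_def by (intro antisym INF_lower INF_greatest) auto

lemma W_powr_le:
  assumes "\<rho> \<in> P" "\<nu> \<in> P"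
  shows "W \<rho> \<mu>star powr p \<le> 2 powr p * (W \<rho> \<nu> powr p + W \<nu> \<mu>star powr p)"
proof -
  have "W \<rho> \<mu>star \<le> 2 * max (W \<rho> \<nu>) (W \<nu> \<mu>star)"
    using W_triangle[OF assms \<mu>star] by simp
  then have "W \<rho> \<mu>star powr p \<le> (2 * max (W \<rho> \<nu>) (W \<nu> \<mu>star)) powr p"
    using p by (intro powr_mono2) auto
  also have "\<dots> \<le> 2 powr p * (W \<rho> \<nu> powr p + W \<nu> \<mu>star powr p)"
    by (auto simp: powr_mult max_def)
  finally show ?thesis .
qed

text \<open>Recentering the lower bound from \<open>\<mu>star\<close> to \<open>\<nu>\<close> turns
  \<open>B\<close> into \<open>B * 2 powr p\<close>. Once \<open>pen r\<close> exceeds this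
  constant, that is for small \<open>r\<close>, the penalty dominates; the thresholds on
  \<open>pen\<close> below originate here.\<close>

lemma \<phi>_pen_lower_bound:
  assumes "\<rho> \<in> P" "\<nu> \<in> P"
  shows "ereal ((pen r - B * 2 powr p) * W \<rho> \<nu> powr p - A - B * 2 powr p * W \<nu> \<mu>star powr p)
    \<le> \<phi> \<rho> + ereal (pen r * W \<rho> \<nu> powr p)"
proof -
  have "B * W \<rho> \<mu>star powr p \<le> B * (2 powr p * (W \<rho> \<nu> powr p + W \<nu> \<mu>star powr p))"
    using W_powr_le[OF assms] B by (intro mult_left_mono) auto
  then have "ereal ((pen r - B * 2 powr p) * W \<rho> \<nu> powr p - A - B * 2 powr p * W \<nu> \<mu>star powr p)
    \<le> ereal (- A - B * W \<rho> \<mu>star powr p) + ereal (pen r * W \<rho> \<nu> powr p)"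
    by (simp add: algebra_simps)
  also have "\<dots> \<le> \<phi> \<rho> + ereal (pen r * W \<rho> \<nu> powr p)"
    using \<phi>_lower_bound[OF assms(1)] by (intro add_mono) auto
  finally show ?thesis .
qed

lemma moreau_yosida_real:
  assumes \<nu>: "\<nu> \<in> P" "\<phi> \<nu> < \<infinity>" and r: "B * 2 powr p \<le> pen r"
  obtains y where "moreau_yosida p r \<phi> \<nu> = ereal y"
proof -
  have "ereal (- A - B * 2 powr p * W \<nu> \<mu>star powr p) \<le> moreau_yosida p r \<phi> \<nu>"
    unfolding moreau_yosida_eq
  proof (rule INF_greatest)
    fix \<rho> assume \<rho>: "\<rho> \<in> P"
    have "- A - B * 2 powr p * W \<nu> \<mu>star powr p \<le>
        (pen r - B * 2 powr p) * W \<rho> \<nu> powr p - A - B * 2 powr p * W \<nu> \<mu>star powr p"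
      using r by simp
    then show "ereal (- A - B * 2 powr p * W \<nu> \<mu>star powr p) \<le> \<phi> \<rho> + ereal (pen r * W \<rho> \<nu> powr p)"
      using \<phi>_pen_lower_bound[OF \<rho> \<nu>(1), of r] by (meson ereal_less_eq(3) order_trans)
  qed
  moreover have "moreau_yosida p r \<phi> \<nu> < \<infinity>"
    using moreau_yosida_le_self[OF \<nu>(1)] \<nu>(2) by (rule order_le_less_trans)
  ultimately show ?thesis using that by (cases "moreau_yosida p r \<phi> \<nu>") auto
qed

text \<open>The direct method. The extra 1 in the threshold leaves a coefficient of at least 1
  before the power of the distance in the lower bound, so a minimizing sequence stays bounded and
  compactness applies.\<close>

lemma minimizer_exists:
  assumes \<nu>: "\<nu> \<in> P" "\<phi> \<nu> < \<infinity>" and r: "B * 2 powr p + 1 \<le> pen r"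
  obtains \<sigma> where "\<sigma> \<in> P" "is_min r \<nu> \<sigma>"
proof -
  have r': "B * 2 powr p \<le> pen r" using r by simp
  obtain y where y: "moreau_yosida p r \<phi> \<nu> = ereal y"
    using moreau_yosida_real[OF \<nu> r'] .
  have "\<exists>\<sigma>\<in>P. \<phi> \<sigma> + ereal (pen r * W \<sigma> \<nu> powr p) < ereal (y + 1 / real (Suc j))" for j
  proof -
    have "moreau_yosida p r \<phi> \<nu> < ereal (y + 1 / real (Suc j))" unfolding y by simp
    then show ?thesis by (simp only: moreau_yosida_eq INF_less_iff)
  qed
  then obtain \<sigma>s where \<sigma>s: "\<And>j. \<sigma>s j \<in> P"
    "\<And>j. \<phi> (\<sigma>s j) + ereal (pen r * W (\<sigma>s j) \<nu> powr p) < ereal (y + 1 / real (Suc j))" by metis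
  \<comment> \<open>Almost minimal value minus penalty: a majorant of
    \<open>\<phi> (\<sigma>s j)\<close> whose limit along the subsequence is known, the penalty
    being continuous.\<close>
  define e where "e j = y + 1 / real (Suc j) - pen r * W (\<sigma>s j) \<nu> powr p" for j
  define K where "K = y + 1 + A + B * 2 powr p * W \<nu> \<mu>star powr p"
  have pen0: "0 \<le> pen r" using p by (simp add: pen_def)
  have le1: "1 / real (Suc j) \<le> 1" for j by simp
  have e: "\<phi> (\<sigma>s j) \<le> ereal (e j)" for j
    using \<sigma>s(2)[of j] by (cases "\<phi> (\<sigma>s j)") (auto simp: e_def)
  have eC: "e j \<le> y + 1" for j
  proof -
    have "0 \<le> pen r * W (\<sigma>s j) \<nu> powr p" using pen0 by simp
    then show ?thesis using le1[of j] unfolding e_def by linarith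
  qed
  have WK: "W (\<sigma>s j) \<nu> \<le> K powr (1 / p)" for j
  proof -
    have "ereal ((pen r - B * 2 powr p) * W (\<sigma>s j) \<nu> powr p - A - B * 2 powr p * W \<nu> \<mu>star powr p)
        < ereal (y + 1 / real (Suc j))"
      using \<phi>_pen_lower_bound[OF \<sigma>s(1) \<nu>(1)] \<sigma>s(2) by (rule order_le_less_trans)
    then have "(pen r - B * 2 powr p) * W (\<sigma>s j) \<nu> powr p \<le> K"
      using le1[of j] unfolding K_def less_ereal.simps(1) by linarith
    moreover have "1 * W (\<sigma>s j) \<nu> powr p \<le> (pen r - B * 2 powr p) * W (\<sigma>s j) \<nu> powr p"
      using r by (intro mult_right_mono) auto
    ultimately have "W (\<sigma>s j) \<nu> powr p \<le> K" by simp
    then have "(W (\<sigma>s j) \<nu> powr p) powr (1 / p) \<le> K powr (1 / p)"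
      using p by (intro powr_mono2) auto
    then show ?thesis using p by (simp add: powr_powr)
  qed
  have WD: "W (\<sigma>s j) \<mu>star \<le> K powr (1 / p) + W \<nu> \<mu>star" for j
    using W_triangle[OF \<sigma>s(1)[of j] \<nu>(1) \<mu>star] WK[of j] by linarith
  obtain k \<sigma> where k: "strict_mono k" "\<sigma> \<in> P" "(\<lambda>i. W (\<sigma>s (k i)) \<sigma>) \<longlonglongrightarrow> 0"
    "\<And>L. (\<lambda>i. e (k i)) \<longlonglongrightarrow> L \<Longrightarrow> \<phi> \<sigma> \<le> ereal L"
    using \<phi>_compact_lsc[of \<sigma>s e, OF \<sigma>s(1) e eC WD] by blast
  have inv0: "(\<lambda>i. 1 / real (Suc (k i))) \<longlonglongrightarrow> 0"
    using LIMSEQ_subseq_LIMSEQ[OF LIMSEQ_inverse_real_of_nat k(1)] by (simp add: comp_def inverse_eq_divide)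
  have "(\<lambda>i. W (\<sigma>s (k i)) \<nu>) \<longlonglongrightarrow> W \<sigma> \<nu>"
    by (rule tendsto_W_const[OF \<sigma>s(1) k(2) \<nu>(1) k(3)])
  then have "(\<lambda>i. e (k i)) \<longlonglongrightarrow> y + 0 - pen r * W \<sigma> \<nu> powr p"
    unfolding e_def using p by (intro tendsto_intros inv0 tendsto_powr') auto
  from k(4)[OF this] have "\<phi> \<sigma> + ereal (pen r * W \<sigma> \<nu> powr p) \<le> ereal y"
    by (cases "\<phi> \<sigma>") auto
  then have "is_min r \<nu> \<sigma>"
    unfolding is_min_def using moreau_yosida_le[where r=r and \<psi>=\<phi> and \<nu>=\<nu>] y by (metis order_trans)
  with k(2) show ?thesis using that by blast
qed

lemma is_min_le:
  assumes "is_min r \<nu> \<sigma>" "\<nu> \<in> P"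
  shows "\<phi> \<sigma> + ereal (pen r * W \<sigma> \<nu> powr p) \<le> \<phi> \<nu>"
  using assms(1)[unfolded is_min_def, rule_format, OF assms(2)] assms(2) p
  by (simp add: zero_ereal_def[symmetric])

lemma is_min_finite:
  assumes "\<sigma> \<in> P" "is_min r \<nu> \<sigma>" "\<nu> \<in> P" "\<phi> \<nu> < \<infinity>"
  obtains f where "\<phi> \<sigma> = ereal f"
  using is_min_le[OF assms(2,3)] assms(4) \<phi>_proper[OF assms(1)] by (cases "\<phi> \<sigma>") auto

section \<open>Slopes at minimizers and decay of the Moreau-Yosida approximation\<close>

text \<open>Minimality bounds \<open>\<phi> \<sigma> - \<phi> \<rho>\<close> by the increase of the
  penalty from \<open>\<sigma>\<close> to \<open>\<rho>\<close>. By convexity its difference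
  quotient is at most the derivative at distance
  \<open>W \<sigma> \<nu> + W \<rho> \<sigma>\<close>, where \<open>p * pen r\<close> equals
  \<open>r powr (1 - p)\<close>.\<close>

lemma local_slope_minimizer_le:
  assumes \<sigma>: "\<sigma> \<in> P" and min: "is_min r \<nu> \<sigma>" and \<nu>: "\<nu> \<in> P" "\<phi> \<nu> < \<infinity>" and r: "0 < r"
  shows "local_slope p \<phi> \<sigma> \<le> ereal ((W \<sigma> \<nu> / r) powr (p - 1))"
proof -
  define F where "F = inf (filtercomap (\<lambda>\<rho>. W \<rho> \<sigma>) (at_right 0)) (principal P)"
  obtain f where f: "\<phi> \<sigma> = ereal f" using is_min_finite[OF \<sigma> min \<nu>] .
  have slope: "local_slope p \<phi> \<sigma> = Limsup F (\<lambda>\<rho>. max 0 (\<phi> \<sigma> - \<phi> \<rho>) / ereal (W \<sigma> \<rho>))"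
    by (simp add: local_slope_def F_def)
  have F1: "\<forall>\<^sub>F \<rho> in F. \<rho> \<in> P" by (simp add: F_def eventually_inf_principal)
  have lim: "filterlim (\<lambda>\<rho>. W \<rho> \<sigma>) (at_right 0) F"
    unfolding F_def by (rule filterlim_mono[OF filterlim_filtercomap]) auto
  have F2: "\<forall>\<^sub>F \<rho> in F. 0 < W \<rho> \<sigma>"
    using lim by (auto simp: filterlim_at elim: eventually_mono)
  have "\<forall>\<^sub>F \<rho> in F. max 0 (\<phi> \<sigma> - \<phi> \<rho>) / ereal (W \<sigma> \<rho>) \<le> ereal (((W \<sigma> \<nu> + W \<rho> \<sigma>) / r) powr (p - 1))"
    using F1 F2
  proof eventually_elim
    fix \<rho> assume \<rho>: "\<rho> \<in> P" and pos: "0 < W \<rho> \<sigma>"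
    define w t where "w = W \<sigma> \<nu>" and "t = W \<rho> \<sigma>"
    have wt: "0 \<le> w" "0 < t" using pos by (auto simp: w_def t_def)
    have "W \<rho> \<nu> \<le> w + t" using W_triangle[OF \<rho> \<sigma> \<nu>(1)] by (simp add: w_def t_def)
    then have *: "W \<rho> \<nu> powr p \<le> (w + t) powr p" using p by (intro powr_mono2) auto
    \<comment> \<open>The tangent is taken at the right endpoint \<open>w + t\<close>, which is
      positive even if \<open>w = 0\<close>.\<close>
    have "(w + t) powr p + p * (w + t) powr (p - 1) * (w - (w + t)) \<le> w powr p"
      using wt p by (intro powr_above_tangent) auto
    then have "(w + t) powr p - w powr p \<le> p * (w + t) powr (p - 1) * t" by simp
    with * have "pen r * (W \<rho> \<nu> powr p - w powr p) \<le> pen r * (p * (w + t) powr (p - 1) * t)"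
      using pen_pos[OF r] by (intro mult_left_mono) auto
    also have "\<dots> = ((w + t) / r) powr (p - 1) * t"
      using p wt r by (simp add: pen_def powr_divide)
    finally have key: "pen r * W \<rho> \<nu> powr p - pen r * w powr p \<le> ((w + t) / r) powr (p - 1) * t"
      by (simp add: algebra_simps)
    have "ereal f + ereal (pen r * w powr p) \<le> \<phi> \<rho> + ereal (pen r * W \<rho> \<nu> powr p)"
      using min \<rho> f unfolding is_min_def w_def by auto
    then have "max 0 (\<phi> \<sigma> - \<phi> \<rho>) \<le> ereal (((w + t) / r) powr (p - 1) * t)"
      using key f wt by (cases "\<phi> \<rho>") (auto simp: max_def)
    then have "max 0 (\<phi> \<sigma> - \<phi> \<rho>) / ereal t \<le> ereal (((w + t) / r) powr (p - 1))"
      using wt by (subst ereal_divide_le_pos) (auto simp: mult.commute)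
    then show "max 0 (\<phi> \<sigma> - \<phi> \<rho>) / ereal (W \<sigma> \<rho>) \<le> ereal (((W \<sigma> \<nu> + W \<rho> \<sigma>) / r) powr (p - 1))"
      using W_commute[OF \<rho> \<sigma>] by (simp add: w_def t_def)
  qed
  then have "local_slope p \<phi> \<sigma> \<le> Limsup F (\<lambda>\<rho>. ereal (((W \<sigma> \<nu> + W \<rho> \<sigma>) / r) powr (p - 1)))"
    unfolding slope by (rule Limsup_mono)
  also have "\<dots> \<le> ereal ((W \<sigma> \<nu> / r) powr (p - 1))"
  proof (cases "F = bot")
    case False
    have "((\<lambda>\<rho>. W \<rho> \<sigma>) \<longlongrightarrow> 0) F" using lim filterlim_at by auto
    then have "((\<lambda>\<rho>. ((W \<sigma> \<nu> + W \<rho> \<sigma>) / r) powr (p - 1)) \<longlongrightarrow> ((W \<sigma> \<nu> + 0) / r) powr (p - 1)) F"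
      using p r by (intro tendsto_powr' tendsto_intros) auto
    then show ?thesis using False by (intro eq_refl lim_imp_Limsup) auto
  \<comment> \<open>Along the trivial filter \<open>Limsup\<close> is -\<infinity>.\<close>
  qed (simp add: bot_ereal_def)
  finally show ?thesis .
qed

text \<open>The minimizer at scale \<open>r\<close> is a competitor at the larger scale
  \<open>s\<close>, where its penalty is smaller by
  \<open>(pen r - pen s) * W \<sigma> \<nu> powr p\<close>; \<open>powr_decrease_ge\<close> bounds
  this gain from below.\<close>

lemma moreau_yosida_step:
  assumes \<nu>: "\<nu> \<in> P" and r: "0 < r" "r < s" and \<sigma>: "\<sigma> \<in> P" "is_min r \<nu> \<sigma>"
  shows "moreau_yosida p s \<phi> \<nu> + ereal ((p - 1) / p * (W \<sigma> \<nu> / r) powr p * (r / s) powr p * (s - r))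
    \<le> moreau_yosida p r \<phi> \<nu>"
proof -
  have "(p - 1) / p * (W \<sigma> \<nu> / r) powr p * (r / s) powr p * (s - r)
      = W \<sigma> \<nu> powr p / (p * r powr p) * ((p - 1) * (r / s) powr p * (s - r))"
    using r by (simp add: powr_divide)
  also have "\<dots> \<le> W \<sigma> \<nu> powr p / (p * r powr p) * (r powr p * (r powr (1 - p) - s powr (1 - p)))"
    using powr_decrease_ge[OF p r] p by (intro mult_left_mono) auto
  also have "\<dots> = (r powr (1 - p) - s powr (1 - p)) / p * W \<sigma> \<nu> powr p" using r by simp
  also have "\<dots> = pen r * W \<sigma> \<nu> powr p - pen s * W \<sigma> \<nu> powr p"
  proof -
    have "pen x = x powr (1 - p) / p" if "0 < x" for x
      using that by (simp add: pen_def powr_diff)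
    then show ?thesis using r by (simp add: left_diff_distrib diff_divide_distrib)
  qed
  finally have "moreau_yosida p s \<phi> \<nu> + ereal ((p - 1) / p * (W \<sigma> \<nu> / r) powr p * (r / s) powr p * (s - r))
     \<le> (\<phi> \<sigma> + ereal (pen s * W \<sigma> \<nu> powr p)) + ereal (pen r * W \<sigma> \<nu> powr p - pen s * W \<sigma> \<nu> powr p)"
    using moreau_yosida_le[OF \<sigma>(1)] by (intro add_mono) auto
  also have "\<dots> = \<phi> \<sigma> + ereal (pen r * W \<sigma> \<nu> powr p)" by (cases "\<phi> \<sigma>") auto
  finally show ?thesis using moreau_yosida_min[OF \<sigma>] by simp
qed

text \<open>Here \<open>p / (p - 1)\<close> is the conjugate exponent and \<open>(p - 1) / p\<close>
  its reciprocal. A slope of at least \<open>k\<close> forces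
  \<open>(W \<sigma> \<nu> / r) powr p\<close> to be at least \<open>k powr (p / (p - 1))\<close> at
  every minimizer, and \<open>geometric_partition_descent\<close> sums the resulting steps.\<close>

lemma moreau_yosida_descent:
  assumes \<nu>: "\<nu> \<in> P" "\<phi> \<nu> < \<infinity>" and a: "0 < a" "B * 2 powr p + 1 \<le> pen a" and k: "0 \<le> k"
    and slope: "\<And>r \<sigma>. 0 < r \<Longrightarrow> r \<le> a \<Longrightarrow> \<sigma> \<in> P \<Longrightarrow> is_min r \<nu> \<sigma> \<Longrightarrow> ereal k \<le> local_slope p \<phi> \<sigma>"
  shows "moreau_yosida p a \<phi> \<nu> + ereal ((p - 1) / p * k powr (p / (p - 1)) * a) \<le> \<phi> \<nu>"
proof -
  have pen: "B * 2 powr p + 1 \<le> pen r" if "0 < r" "r \<le> a" for r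
    using pen_antimono[OF that] a by simp
  define f where "f r = real_of_ereal (moreau_yosida p r \<phi> \<nu>)" for r
  have f: "moreau_yosida p r \<phi> \<nu> = ereal (f r)" if r: "0 < r" "r \<le> a" for r
  proof -
    have "B * 2 powr p \<le> pen r" using pen[OF r] by simp
    then obtain y where "moreau_yosida p r \<phi> \<nu> = ereal y" by (rule moreau_yosida_real[OF \<nu>])
    then show ?thesis by (simp add: f_def)
  qed
  obtain M where M: "\<phi> \<nu> = ereal M" using \<nu> \<phi>_proper by (cases "\<phi> \<nu>") auto
  have "(p - 1) / p * k powr (p / (p - 1)) * a \<le> M - f a"
  proof (rule geometric_partition_descent[OF a(1)])
    show "0 \<le> (p - 1) / p * k powr (p / (p - 1))" using p by simp
    fix r assume r: "0 < r" "r \<le> a"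
    show "f r \<le> M" using moreau_yosida_le_self[OF \<nu>(1), of r \<phi>] f[OF r] M by simp
  next
    fix r s assume rs: "0 < r" "r < s" "s \<le> a"
    then have r: "r \<le> a" by simp
    obtain \<sigma> where \<sigma>: "\<sigma> \<in> P" "is_min r \<nu> \<sigma>" using minimizer_exists[OF \<nu> pen[OF rs(1) r]] .
    have "ereal k \<le> local_slope p \<phi> \<sigma>" by (rule slope[OF rs(1) r \<sigma>])
    also have "\<dots> \<le> ereal ((W \<sigma> \<nu> / r) powr (p - 1))"
      by (rule local_slope_minimizer_le[OF \<sigma> \<nu> rs(1)])
    finally have "k powr (p / (p - 1)) \<le> ((W \<sigma> \<nu> / r) powr (p - 1)) powr (p / (p - 1))"
      using k p by (intro powr_mono2) auto
    also have "\<dots> = (W \<sigma> \<nu> / r) powr p" using p by (simp add: powr_powr)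
    finally have "(p - 1) / p * k powr (p / (p - 1)) * ((r / s) powr p * (s - r))
        \<le> (p - 1) / p * (W \<sigma> \<nu> / r) powr p * ((r / s) powr p * (s - r))"
      using p rs by (intro mult_right_mono mult_left_mono) auto
    moreover have "f s + (p - 1) / p * (W \<sigma> \<nu> / r) powr p * (r / s) powr p * (s - r) \<le> f r"
      using moreau_yosida_step[OF \<nu>(1) rs(1,2) \<sigma>] f[OF rs(1) r] f[of s] rs by simp
    ultimately show "(p - 1) / p * k powr (p / (p - 1)) * (r / s) powr p * (s - r) \<le> f r - f s"
      by (simp add: mult.assoc)
  qed
  then show ?thesis using f[of a] a M by simp
qed

section \<open>Localization near the limit point and uniformity in the index\<close>

text \<open>Otherwise shrinking radii yield a sequence converging to \<open>\<nu>\<close> with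
  slopes below \<open>c\<close>. The common energy bound \<open>C\<close> makes it admissible in the
  infimum defining the relaxed slope, hence the restriction to a sublevel.\<close>

lemma local_slope_ge_near:
  assumes c: "ereal c < relaxed_slope p \<phi> \<nu>"
  shows "\<exists>\<delta>>0. \<forall>\<sigma>\<in>P. W \<sigma> \<nu> < \<delta> \<longrightarrow> \<phi> \<sigma> \<le> ereal C \<longrightarrow> ereal c \<le> local_slope p \<phi> \<sigma>"
proof (rule ccontr)
  assume neg: "\<not> ?thesis"
  have "\<exists>\<sigma>\<in>P. W \<sigma> \<nu> < 1 / real (Suc j) \<and> \<phi> \<sigma> \<le> ereal C \<and> local_slope p \<phi> \<sigma> < ereal c" for j
  proof (rule ccontr)
    assume "\<not> ?thesis"
    then have "ereal c \<le> local_slope p \<phi> \<sigma>" if "\<sigma> \<in> P" "W \<sigma> \<nu> < 1 / real (Suc j)" "\<phi> \<sigma> \<le> ereal C" for \<sigma>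
      using that by (auto simp: not_less)
    then have "\<exists>\<delta>>0. \<forall>\<sigma>\<in>P. W \<sigma> \<nu> < \<delta> \<longrightarrow> \<phi> \<sigma> \<le> ereal C \<longrightarrow> ereal c \<le> local_slope p \<phi> \<sigma>"
      by (intro exI[of _ "1 / real (Suc j)"]) auto
    with neg show False ..
  qed
  then obtain \<sigma>s where \<sigma>s: "\<And>j. \<sigma>s j \<in> P" "\<And>j. W (\<sigma>s j) \<nu> < 1 / real (Suc j)"
      "\<And>j. \<phi> (\<sigma>s j) \<le> ereal C" "\<And>j. local_slope p \<phi> (\<sigma>s j) < ereal c" by metis
  have "(\<lambda>j. W (\<sigma>s j) \<nu>) \<longlonglongrightarrow> 0"
    by (rule tendsto_sandwich[OF _ _ tendsto_const LIMSEQ_inverse_real_of_nat])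
      (use \<sigma>s(2) in \<open>auto simp: inverse_eq_divide intro!: always_eventually less_imp_le simp del: of_nat_Suc\<close>)
  moreover have "(SUP j. \<phi> (\<sigma>s j)) < \<infinity>"
    using SUP_least[of UNIV "\<lambda>j. \<phi> (\<sigma>s j)" "ereal C"] \<sigma>s(3) by (auto simp: order_le_less_trans)
  ultimately have "relaxed_slope p \<phi> \<nu> \<le> liminf (\<lambda>j. local_slope p \<phi> (\<sigma>s j))"
    unfolding relaxed_slope_def using \<sigma>s(1) by (intro Inf_lower) blast
  also have "\<dots> \<le> liminf (\<lambda>j. ereal c)"
    using \<sigma>s(4) by (intro Liminf_mono always_eventually) (auto intro: less_imp_le)
  also have "\<dots> = ereal c" by (simp add: Liminf_const)
  finally show False using c by simp
qed

text \<open>At distance at least \<open>\<epsilon>\<close> the penalty would lift the lower bound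
  above \<open>C\<close>, whereas the penalized value of a minimizer is at most
  \<open>\<phi> \<nu>\<close>.\<close>

lemma minimizer_near:
  assumes \<nu>: "\<nu> \<in> P" "\<phi> \<nu> \<le> ereal C" "W \<nu> \<mu>star \<le> D" and \<sigma>: "\<sigma> \<in> P" "is_min r \<nu> \<sigma>"
    and \<epsilon>: "0 < \<epsilon>" "C + A + B * 2 powr p * D powr p < (pen r - B * 2 powr p) * \<epsilon> powr p"
    and r: "B * 2 powr p \<le> pen r"
  shows "W \<sigma> \<nu> < \<epsilon>"
proof (rule ccontr)
  assume "\<not> W \<sigma> \<nu> < \<epsilon>"
  then have "(pen r - B * 2 powr p) * \<epsilon> powr p \<le> (pen r - B * 2 powr p) * W \<sigma> \<nu> powr p"
    using r \<epsilon> p by (intro mult_left_mono powr_mono2) auto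
  moreover have "B * 2 powr p * W \<nu> \<mu>star powr p \<le> B * 2 powr p * D powr p"
    using \<nu>(3) B p by (intro mult_left_mono powr_mono2) auto
  moreover have "ereal ((pen r - B * 2 powr p) * W \<sigma> \<nu> powr p - A - B * 2 powr p * W \<nu> \<mu>star powr p) \<le> ereal C"
    using \<phi>_pen_lower_bound[OF \<sigma>(1) \<nu>(1), of r] is_min_le[OF \<sigma>(2) \<nu>(1)] \<nu>(2) by (meson order_trans)
  ultimately show False using \<epsilon> unfolding ereal_less_eq(3) by linarith
qed

text \<open>The point \<open>\<nu>\<close> cannot be kept: \<open>\<phi> \<nu>\<close> need not be comparable with \<open>\<phi>n n \<nu>\<close>, only with a nearby \<open>\<nu>'\<close>,
  a limit point produced by compactness.\<close>

lemma gamma_uniform: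
  assumes a: "B * 2 powr p \<le> pen a" and \<eta>: "0 < \<eta>"
  obtains N where "\<And>n \<nu>. N \<le> n \<Longrightarrow> \<nu> \<in> P \<Longrightarrow> \<phi>n n \<nu> \<le> ereal C \<Longrightarrow> W \<nu> \<mu>star \<le> C \<Longrightarrow>
    \<exists>\<nu>'\<in>P. W \<nu> \<nu>' \<le> \<eta> \<and> \<phi> \<nu>' \<le> \<phi>n n \<nu> + ereal \<eta> \<and>
      moreau_yosida p a (\<phi>n n) \<nu> \<le> moreau_yosida p a \<phi> \<nu>' + ereal \<eta>"
proof (rule ccontr)
  define bad where "bad n \<nu> \<longleftrightarrow> \<nu> \<in> P \<and> \<phi>n n \<nu> \<le> ereal C \<and> W \<nu> \<mu>star \<le> C \<and>
    \<not> (\<exists>\<nu>'\<in>P. W \<nu> \<nu>' \<le> \<eta> \<and> \<phi> \<nu>' \<le> \<phi>n n \<nu> + ereal \<eta> \<and>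
      moreau_yosida p a (\<phi>n n) \<nu> \<le> moreau_yosida p a \<phi> \<nu>' + ereal \<eta>)" for n \<nu>
  assume "\<not> thesis"
  have "\<forall>N. \<exists>n\<ge>N. \<exists>\<nu>. bad n \<nu>"
  proof (rule allI, rule ccontr)
    fix N assume "\<not> (\<exists>n\<ge>N. \<exists>\<nu>. bad n \<nu>)"
    then have "\<not> bad n \<nu>" if "N \<le> n" for n \<nu> using that by blast
    then have thesis by (intro that[of N]) (unfold bad_def, blast)
    with \<open>\<not> thesis\<close> show False ..
  qed
  then have inf: "infinite {n. \<exists>\<nu>. bad n \<nu>}"
    by (simp add: infinite_nat_iff_unbounded_le)
  \<comment> \<open>Enumerating the bad indices gives an increasing \<open>m\<close> along which
    coercivity is available.\<close>
  define m where "m = enumerate {n. \<exists>\<nu>. bad n \<nu>}"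
  have m: "strict_mono m" unfolding m_def by (rule strict_mono_enumerate[OF inf])
  have "\<forall>j. \<exists>\<nu>. bad (m j) \<nu>" using enumerate_in_set[OF inf] by (auto simp: m_def)
  then obtain \<nu>s where bad: "\<And>j. bad (m j) (\<nu>s j)" by metis
  then have \<nu>s: "\<And>j. \<nu>s j \<in> P" "\<And>j. \<phi>n (m j) (\<nu>s j) \<le> ereal C" "\<And>j. W (\<nu>s j) \<mu>star \<le> C"
    by (auto simp: bad_def)
  obtain k \<nu>' where k: "strict_mono k" and \<nu>': "\<nu>' \<in> P" and lim: "(\<lambda>i. W (\<nu>s (k i)) \<nu>') \<longlonglongrightarrow> 0"
    by (rule equi_coerciveD[OF m \<nu>s])
  have mk: "strict_mono (m \<circ> k)" using m k by (rule strict_mono_o)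
  have liminf: "\<phi> \<nu>' \<le> liminf (\<lambda>i. \<phi>n (m (k i)) (\<nu>s (k i)))"
    using gamma_liminf_subseq[OF \<nu>' mk _ lim] \<nu>s(1) by simp
  also have "\<dots> \<le> liminf (\<lambda>i. ereal C)" using \<nu>s(2) by (intro Liminf_mono always_eventually) auto
  finally have \<phi>C: "\<phi> \<nu>' \<le> ereal C" by (simp add: Liminf_const)
  then have \<phi>fin: "\<phi> \<nu>' < \<infinity>" by auto
  obtain f where f: "\<phi> \<nu>' = ereal f" using \<phi>fin \<phi>_proper[OF \<nu>'] by (cases "\<phi> \<nu>'") auto
  have "ereal (f - \<eta>) < ereal f" using \<eta> by simp
  also have "\<dots> \<le> liminf (\<lambda>i. \<phi>n (m (k i)) (\<nu>s (k i)))" using liminf unfolding f .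
  finally have "ereal (f - \<eta>) < liminf (\<lambda>i. \<phi>n (m (k i)) (\<nu>s (k i)))" .
  then have ev1: "\<forall>\<^sub>F i in sequentially. \<phi> \<nu>' \<le> \<phi>n (m (k i)) (\<nu>s (k i)) + ereal \<eta>"
  proof (rule eventually_mono[OF less_LiminfD])
    fix i assume *: "ereal (f - \<eta>) < \<phi>n (m (k i)) (\<nu>s (k i))"
    then show "\<phi> \<nu>' \<le> \<phi>n (m (k i)) (\<nu>s (k i)) + ereal \<eta>"
      unfolding f by (cases "\<phi>n (m (k i)) (\<nu>s (k i))") auto
  qed
  have ev2: "\<forall>\<^sub>F i in sequentially. W (\<nu>s (k i)) \<nu>' < \<eta>"
    by (rule order_tendstoD(2)[OF lim \<eta>])
  obtain y where y: "moreau_yosida p a \<phi> \<nu>' = ereal y" using moreau_yosida_real[OF \<nu>' \<phi>fin a] .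
  \<comment> \<open>An almost minimizer \<open>\<sigma>\<close> of the limit problem at
    \<open>\<nu>'\<close> is chosen; its recovery sequence supplies competitors for the
    approximations at \<open>\<nu>s (k i)\<close>.\<close>
  have "moreau_yosida p a \<phi> \<nu>' < ereal (y + \<eta>)" using y \<eta> by simp
  then obtain \<sigma> where \<sigma>: "\<sigma> \<in> P" and \<sigma>y: "\<phi> \<sigma> + ereal (pen a * W \<sigma> \<nu>' powr p) < ereal (y + \<eta>)"
    by (auto simp: moreau_yosida_eq INF_less_iff)
  obtain \<sigma>s where \<sigma>s: "\<And>n. \<sigma>s n \<in> P" "(\<lambda>n. W (\<sigma>s n) \<sigma>) \<longlonglongrightarrow> 0" "(\<lambda>n. \<phi>n n (\<sigma>s n)) \<longlonglongrightarrow> \<phi> \<sigma>"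
    by (rule recovery_sequence[OF \<sigma>]) blast
  have "(\<lambda>i. W (\<sigma>s (m (k i))) (\<nu>s (k i))) \<longlonglongrightarrow> W \<sigma> \<nu>'"
    using LIMSEQ_subseq_LIMSEQ[OF \<sigma>s(2) mk] lim \<sigma>s(1) \<nu>s(1) \<sigma> \<nu>' by (intro tendsto_W) (auto simp: comp_def)
  then have "(\<lambda>i. ereal (pen a * W (\<sigma>s (m (k i))) (\<nu>s (k i)) powr p)) \<longlonglongrightarrow> ereal (pen a * W \<sigma> \<nu>' powr p)"
    using p by (intro tendsto_intros tendsto_powr') auto
  moreover have "(\<lambda>i. \<phi>n (m (k i)) (\<sigma>s (m (k i)))) \<longlonglongrightarrow> \<phi> \<sigma>"
    using LIMSEQ_subseq_LIMSEQ[OF \<sigma>s(3) mk] by (simp add: comp_def)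
  ultimately have "(\<lambda>i. \<phi>n (m (k i)) (\<sigma>s (m (k i))) + ereal (pen a * W (\<sigma>s (m (k i))) (\<nu>s (k i)) powr p))
      \<longlonglongrightarrow> \<phi> \<sigma> + ereal (pen a * W \<sigma> \<nu>' powr p)"
    using \<phi>_proper[OF \<sigma>] by (intro tendsto_add_ereal_general) auto
  from order_tendstoD(2)[OF this \<sigma>y]
  have ev3: "\<forall>\<^sub>F i in sequentially. moreau_yosida p a (\<phi>n (m (k i))) (\<nu>s (k i)) < ereal (y + \<eta>)"
    by (rule eventually_mono) (rule order_le_less_trans[OF moreau_yosida_le[OF \<sigma>s(1)]])
  have "\<forall>\<^sub>F i in sequentially. False"
    using ev1 ev2 ev3
  proof eventually_elim
    case (elim i)
    have "moreau_yosida p a (\<phi>n (m (k i))) (\<nu>s (k i)) \<le> moreau_yosida p a \<phi> \<nu>' + ereal \<eta>"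
      using elim(3) y by simp
    with elim(1,2) bad[of "k i"] \<nu>' show False unfolding bad_def using less_imp_le by blast
  qed
  then show False by simp
qed

text \<open>\<open>local_slope\<close> is a \<open>Limsup\<close>, hence \<open>-\<infinity>\<close>, not \<open>0\<close>, along a trivial filter (an isolated point).
  Other negative values must be excluded because \<open>x powr q\<close> is positive for negative \<open>x\<close>.\<close>

lemma local_slope_cases: "local_slope p \<phi> \<mu> = -\<infinity> \<or> 0 \<le> local_slope p \<phi> \<mu>"
proof -
  define F where "F = inf (filtercomap (\<lambda>\<nu>. W \<nu> \<mu>) (at_right 0)) (principal P)"
  have "0 \<le> Limsup F (\<lambda>\<nu>. max 0 (\<phi> \<mu> - \<phi> \<nu>) / ereal (W \<mu> \<nu>))" if "F \<noteq> bot"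
    using that by (intro le_Limsup always_eventually allI zero_le_divide_ereal) auto
  then show ?thesis unfolding local_slope_def F_def[symmetric] by (cases "F = bot") (auto simp: bot_ereal_def)
qed

text \<open>A negative value needs a sequence of slopes with negative liminf. Were this liminf above
  -\<infinity>, the slopes would eventually be nonnegative, and so would the liminf.\<close>

lemma relaxed_slope_cases: "relaxed_slope p \<phi> \<nu> = -\<infinity> \<or> 0 \<le> relaxed_slope p \<phi> \<nu>"
proof (rule disjCI)
  assume "\<not> 0 \<le> relaxed_slope p \<phi> \<nu>"
  then obtain \<mu>s where \<mu>s: "(\<forall>n. \<mu>s n \<in> P) \<and> (\<lambda>n. W (\<mu>s n) \<nu>) \<longlonglongrightarrow> 0 \<and> (SUP n. \<phi> (\<mu>s n)) < \<infinity>"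
    "liminf (\<lambda>n. local_slope p \<phi> (\<mu>s n)) < 0"
    by (auto simp: relaxed_slope_def not_le Inf_less_iff)
  have "liminf (\<lambda>n. local_slope p \<phi> (\<mu>s n)) = -\<infinity>"
  proof (rule ccontr)
    assume "liminf (\<lambda>n. local_slope p \<phi> (\<mu>s n)) \<noteq> -\<infinity>"
    then have "-\<infinity> < liminf (\<lambda>n. local_slope p \<phi> (\<mu>s n))" by auto
    then have "\<forall>\<^sub>F n in sequentially. -\<infinity> < local_slope p \<phi> (\<mu>s n)" by (rule less_LiminfD)
    then have "\<forall>\<^sub>F n in sequentially. 0 \<le> local_slope p \<phi> (\<mu>s n)"
      by (rule eventually_mono) (metis local_slope_cases less_irrefl)
    then show False using Liminf_bounded \<mu>s(2) by (metis not_le)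
  qed
  then have "relaxed_slope p \<phi> \<nu> \<le> -\<infinity>"
    unfolding relaxed_slope_def using \<mu>s(1) by (intro Inf_lower) (auto intro!: exI[of _ \<mu>s])
  then show "relaxed_slope p \<phi> \<nu> = -\<infinity>" by simp
qed

lemma filterlim_pen: "filterlim pen at_top (at_right 0)"
proof -
  have "((\<lambda>r. p * r powr (p - 1)) \<longlongrightarrow> p * 0 powr (p - 1)) (at_right 0)"
    using p by (intro tendsto_intros tendsto_powr') (auto intro!: eventually_mono[OF eventually_at_right_less])
  then have "filterlim (\<lambda>r. inverse (p * r powr (p - 1))) at_top (at_right 0)"
    using p by (intro filterlim_inverse_at_top) (auto intro: eventually_mono[OF eventually_at_right_less])
  then show ?thesis by (simp add: pen_def[abs_def] inverse_eq_divide)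
qed

text \<open>The last assumption is the threshold of \<open>minimizer_near\<close> for radius
  \<open>\<delta> / 2\<close> and distance bound \<open>W \<nu> \<mu>star + \<delta>\<close>, solved
  for \<open>pen\<close>. Minimizers for \<open>\<nu>'\<close> then lie within
  \<open>\<delta>\<close> of \<open>\<nu>\<close> with energy at most \<open>\<phi> \<nu>'\<close>,
  so the slope bound holds at all of them.\<close>

lemma descent_near:
  assumes \<delta>: "0 < \<delta>" "\<And>\<sigma>. \<sigma> \<in> P \<Longrightarrow> W \<sigma> \<nu> < \<delta> \<Longrightarrow> \<phi> \<sigma> \<le> ereal C \<Longrightarrow> ereal c \<le> local_slope p \<phi> \<sigma>"
    and c: "0 \<le> c" and \<nu>: "\<nu> \<in> P" and \<nu>': "\<nu>' \<in> P" "W \<nu>' \<nu> \<le> \<delta> / 2" "\<phi> \<nu>' \<le> ereal C"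
    and a: "0 < a" "B * 2 powr p + 1 \<le> pen a"
      "(C + A + B * 2 powr p * (W \<nu> \<mu>star + \<delta>) powr p) / (\<delta> / 2) powr p + B * 2 powr p < pen a"
  shows "moreau_yosida p a \<phi> \<nu>' + ereal ((p - 1) / p * c powr (p / (p - 1)) * a) \<le> \<phi> \<nu>'"
proof (rule moreau_yosida_descent[OF \<nu>'(1) _ a(1,2) c])
  show "\<phi> \<nu>' < \<infinity>" using \<nu>'(3) by auto
  fix r \<sigma> assume r: "0 < r" "r \<le> a" and \<sigma>: "\<sigma> \<in> P" "is_min r \<nu>' \<sigma>"
  have pen: "pen a \<le> pen r" by (rule pen_antimono[OF r])
  have D: "W \<nu>' \<mu>star \<le> W \<nu> \<mu>star + \<delta>"
    using W_triangle[OF \<nu>'(1) \<nu> \<mu>star] \<nu>'(2) \<delta>(1) by linarith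
  have "(C + A + B * 2 powr p * (W \<nu> \<mu>star + \<delta>) powr p) / (\<delta> / 2) powr p < pen r - B * 2 powr p"
    using a(3) pen by linarith
  then have *: "C + A + B * 2 powr p * (W \<nu> \<mu>star + \<delta>) powr p < (pen r - B * 2 powr p) * (\<delta> / 2) powr p"
    using \<delta>(1) by (simp add: pos_divide_less_eq)
  have "W \<sigma> \<nu>' < \<delta> / 2"
    by (rule minimizer_near[OF \<nu>'(1,3) D \<sigma> _ *]) (use \<delta>(1) a(2) pen in linarith)+
  then have near: "W \<sigma> \<nu> < \<delta>" using W_triangle[OF \<sigma>(1) \<nu>'(1) \<nu>] \<nu>'(2) by linarith
  have "\<phi> \<sigma> + 0 \<le> \<phi> \<sigma> + ereal (pen r * W \<sigma> \<nu>' powr p)"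
    using pen_pos[OF r(1)] by (intro add_left_mono) simp
  then have "\<phi> \<sigma> \<le> ereal C" using is_min_le[OF \<sigma>(2) \<nu>'(1)] \<nu>'(3) by (auto intro: order_trans)
  then show "ereal c \<le> local_slope p \<phi> \<sigma>" using \<delta>(2) \<sigma>(1) near by blast
qed

end

section \<open>From levels below the slope to the liminf inequality\<close>

text \<open>Real levels \<open>c\<close> below \<open>R\<close> cover finite and infinite slopes
  alike: either \<open>c\<close> tends to \<open>R\<close>, or \<open>K * c powr q\<close> becomes
  arbitrarily large.\<close>

lemma ereal_powr_le_of_below:
  fixes R L :: ereal
  assumes q: "0 < q" and R: "R = -\<infinity> \<or> 0 \<le> R" and L: "0 \<le> L" and K: "0 < K"
    and below: "\<And>c. 0 \<le> c \<Longrightarrow> ereal c < R \<Longrightarrow> ereal (K * c powr q) \<le> L"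
  shows "ereal K * ereal_powr R q \<le> L"
proof (cases R)
  case (real r)
  show ?thesis
  proof (cases "0 < r")
    case True
    have "((\<lambda>c. ereal (K * c powr q)) \<longlongrightarrow> ereal (K * r powr q)) (at_left r)"
      using True by (intro tendsto_intros) auto
    moreover have "\<forall>\<^sub>F c in at_left r. ereal (K * c powr q) \<le> L"
      by (rule eventually_mono[OF eventually_at_left_real[OF True]]) (use below real in auto)
    ultimately have "ereal (K * r powr q) \<le> L" by (rule tendsto_upperbound) simp
    then show ?thesis by (simp add: real ereal_powr_def)
  qed (use R L real in \<open>auto simp: ereal_powr_def zero_ereal_def\<close>)
next
  case PInf
  have "ereal x \<le> L" for x
  proof -
    define c where "c = (max x 0 / K) powr (1 / q)"
    have "ereal (K * c powr q) \<le> L" by (rule below) (auto simp: c_def PInf)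
    moreover have "K * c powr q = max x 0" using q K by (simp add: c_def powr_powr)
    ultimately show ?thesis by (metis ereal_less_eq(3) max.cobounded1 order_trans)
  qed
  then have "L = \<infinity>" by (rule ereal_top)
  then show ?thesis by simp
\<comment> \<open>As \<open>real_of_ereal\<close> sends -\<infinity> to 0, so does
  \<open>ereal_powr\<close>, and the claim is \<open>0 \<le> L\<close>.\<close>
qed (use L in \<open>simp add: ereal_powr_def zero_ereal_def\<close>)

theorem theorem3p17:
  fixes p q A B :: real
    and \<phi>n :: "nat \<Rightarrow> (real ^ 'd) measure \<Rightarrow> ereal"
    and \<phi> :: "(real ^ 'd) measure \<Rightarrow> ereal"
    and \<mu>star :: "(real ^ 'd) measure"
  assumes conj_exponents: "1 < p" "1 < q" "1 / p + 1 / q = 1"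
    and \<phi>n_proper: "\<And>n \<mu>. \<mu> \<in> P_space p \<Longrightarrow> -\<infinity> < \<phi>n n \<mu>"
    and \<phi>_proper: "\<And>\<mu>. \<mu> \<in> P_space p \<Longrightarrow> -\<infinity> < \<phi> \<mu>"
    and AB: "A > 0" "B > 0"
    and \<mu>star: "\<mu>star \<in> P_space p"
    and lower_bound:
      "\<And>n \<mu>. \<mu> \<in> P_space p \<Longrightarrow> \<phi>n n \<mu> \<ge> ereal (- A - B * wasserstein p \<mu> \<mu>star powr p)"
    and coercive: "equi_coercive p \<phi>n \<mu>star"
    and gamma: "gamma_converges p \<phi>n \<phi>"
  shows "\<exists>N :: real \<Rightarrow> nat.
    antimono_on {0<..} N \<and> filterlim N at_top (at_right 0) \<and>
    (\<forall>n :: real \<Rightarrow> nat. (\<forall>\<tau>>0. N \<tau> \<le> n \<tau>) \<longrightarrow>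
      (\<forall>(\<nu>s :: real \<Rightarrow> (real ^ 'd) measure) \<nu>.
        (\<forall>\<tau>>0. \<nu>s \<tau> \<in> P_space p) \<and> \<nu> \<in> P_space p \<and>
        ((\<lambda>\<tau>. wasserstein p (\<nu>s \<tau>) \<nu>) \<longlongrightarrow> 0) (at_right 0) \<and>
        (SUP \<tau>\<in>{0<..}. \<phi>n (n \<tau>) (\<nu>s \<tau>)) < \<infinity> \<longrightarrow>
        Liminf (at_right 0)
          (\<lambda>\<tau>. (\<phi>n (n \<tau>) (\<nu>s \<tau>) - moreau_yosida p \<tau> (\<phi>n (n \<tau>)) (\<nu>s \<tau>)) / ereal \<tau>)
        \<ge> ereal (1 / q) * ereal_powr (relaxed_slope p \<phi> \<nu>) q))"
proof -
  interpret gamma_limit p A B \<phi>n \<phi> \<mu>star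
    by unfold_locales (use assms in auto)
  have q: "q = p / (p - 1)" "1 / q = (p - 1) / p"
    using conj_exponents by (auto simp: field_simps)
  \<comment> \<open>Discretized scales: for positive \<open>\<tau>\<close>, \<open>a \<tau>\<close>
    is the largest \<open>\<alpha> j\<close> strictly below \<open>\<tau>\<close>, and the ratio
    \<open>a \<tau> / \<tau>\<close> tends to 1.\<close>
  define \<alpha> where "\<alpha> j = 1 / (real j + 1)" for j :: nat
  define k where "k \<tau> = nat \<lfloor>1 / \<tau>\<rfloor>" for \<tau> :: real
  define a where "a \<tau> = \<alpha> (k \<tau>)" for \<tau>
  have \<alpha>: "0 < \<alpha> j" "\<alpha> j \<le> 1" for j by (auto simp: \<alpha>_def)
  have a_pos: "0 < a \<tau>" for \<tau> by (simp add: a_def \<alpha>)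
  have a_le: "a \<tau> \<le> \<tau>" and a_ge: "\<tau> / (1 + \<tau>) \<le> a \<tau>" if "0 < \<tau>" for \<tau>
  proof -
    have k: "real (k \<tau>) = of_int \<lfloor>1 / \<tau>\<rfloor>" using that by (simp add: k_def)
    have "1 / \<tau> \<le> real (k \<tau>) + 1" "real (k \<tau>) \<le> 1 / \<tau>" unfolding k by linarith+
    then show "a \<tau> \<le> \<tau>" "\<tau> / (1 + \<tau>) \<le> a \<tau>" using that by (simp_all add: a_def \<alpha>_def field_simps)
  qed
  have k_top: "filterlim k at_top (at_right 0)"
    unfolding k_def using filterlim_inverse_at_top_right
    by (intro filterlim_compose[OF filterlim_nat_sequentially] filterlim_compose[OF filterlim_floor_sequentially])
      (simp add: inverse_eq_divide)
  have a_0: "filterlim a (at_right 0) (at_right 0)"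
    unfolding filterlim_at
  proof (intro conjI tendsto_sandwich[OF _ _ tendsto_const tendsto_ident_at])
    show "\<forall>\<^sub>F \<tau> in at_right 0. a \<tau> \<le> \<tau>"
      by (rule eventually_mono[OF eventually_at_right_less]) (rule a_le)
  qed (use a_pos in \<open>auto simp: less_imp_le less_imp_neq[THEN not_sym]\<close>)
  \<comment> \<open>The accuracy \<open>(\<alpha> j)\<^sup>2\<close> is negligible against the scale
    \<open>\<alpha> j\<close>, and the bound \<open>j\<close> eventually exceeds any fixed bound on
    energies and distances.\<close>
  have "\<exists>N. B * 2 powr p \<le> pen (\<alpha> j) \<longrightarrow> (\<forall>n \<nu>. N \<le> n \<longrightarrow> \<nu> \<in> P \<longrightarrow> \<phi>n n \<nu> \<le> ereal (real j) \<longrightarrow>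
      W \<nu> \<mu>star \<le> real j \<longrightarrow> (\<exists>\<nu>'\<in>P. W \<nu> \<nu>' \<le> (\<alpha> j)\<^sup>2 \<and> \<phi> \<nu>' \<le> \<phi>n n \<nu> + ereal ((\<alpha> j)\<^sup>2) \<and>
      moreau_yosida p (\<alpha> j) (\<phi>n n) \<nu> \<le> moreau_yosida p (\<alpha> j) \<phi> \<nu>' + ereal ((\<alpha> j)\<^sup>2)))" for j
  proof (cases "B * 2 powr p \<le> pen (\<alpha> j)")
    case True
    have "0 < (\<alpha> j)\<^sup>2" using \<alpha>(1)[of j] by simp
    from gamma_uniform[OF True this, of "real j"] show ?thesis by metis
  qed auto
  then obtain N0 where N0: "\<And>j n \<nu>. B * 2 powr p \<le> pen (\<alpha> j) \<Longrightarrow> N0 j \<le> n \<Longrightarrow> \<nu> \<in> P \<Longrightarrow>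
      \<phi>n n \<nu> \<le> ereal (real j) \<Longrightarrow> W \<nu> \<mu>star \<le> real j \<Longrightarrow>
      \<exists>\<nu>'\<in>P. W \<nu> \<nu>' \<le> (\<alpha> j)\<^sup>2 \<and> \<phi> \<nu>' \<le> \<phi>n n \<nu> + ereal ((\<alpha> j)\<^sup>2) \<and>
      moreau_yosida p (\<alpha> j) (\<phi>n n) \<nu> \<le> moreau_yosida p (\<alpha> j) \<phi> \<nu>' + ereal ((\<alpha> j)\<^sup>2)"
    by metis
  \<comment> \<open>The sum dominates \<open>N0 (k \<tau>)\<close> and is monotone in
    \<open>k \<tau>\<close>; the summand \<open>k \<tau>\<close> forces divergence.\<close>
  define N where "N \<tau> = k \<tau> + (\<Sum>j\<le>k \<tau>. N0 j)" for \<tau>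
  have N_mono: "antimono_on {0<..} N"
  proof (rule monotone_onI)
    fix x y :: real assume "x \<in> {0<..}" "y \<in> {0<..}" "x \<le> y"
    then have "k y \<le> k x" unfolding k_def by (intro nat_mono floor_mono divide_left_mono) auto
    then show "N y \<le> N x" unfolding N_def by (intro add_mono sum_mono2) auto
  qed
  have N_top: "filterlim N at_top (at_right 0)"
    by (rule filterlim_at_top_mono[OF k_top]) (simp add: N_def)
  have main: "ereal (1 / q) * ereal_powr (relaxed_slope p \<phi> \<nu>) q \<le>
      Liminf (at_right 0) (\<lambda>\<tau>. (\<phi>n (n \<tau>) (\<nu>s \<tau>) - moreau_yosida p \<tau> (\<phi>n (n \<tau>)) (\<nu>s \<tau>)) / ereal \<tau>)"
    if n: "\<And>\<tau>. 0 < \<tau> \<Longrightarrow> N \<tau> \<le> n \<tau>" and \<nu>s: "\<And>\<tau>. 0 < \<tau> \<Longrightarrow> \<nu>s \<tau> \<in> P" and \<nu>: "\<nu> \<in> P"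
      and lim: "((\<lambda>\<tau>. W (\<nu>s \<tau>) \<nu>) \<longlongrightarrow> 0) (at_right 0)"
      and sup: "(SUP \<tau>\<in>{0<..}. \<phi>n (n \<tau>) (\<nu>s \<tau>)) < \<infinity>" for n \<nu>s \<nu>
  proof (rule ereal_powr_le_of_below[OF _ relaxed_slope_cases])
    define D where "D \<tau> = (\<phi>n (n \<tau>) (\<nu>s \<tau>) - moreau_yosida p \<tau> (\<phi>n (n \<tau>)) (\<nu>s \<tau>)) / ereal \<tau>" for \<tau>
    have "\<exists>C::real. (SUP \<tau>\<in>{0<..}. \<phi>n (n \<tau>) (\<nu>s \<tau>)) \<le> ereal C"
      using sup by (cases "SUP \<tau>\<in>{0<..}. \<phi>n (n \<tau>) (\<nu>s \<tau>)") auto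
    then obtain C where C: "(SUP \<tau>\<in>{0<..}. \<phi>n (n \<tau>) (\<nu>s \<tau>)) \<le> ereal C" ..
    have \<phi>nC: "\<phi>n (n \<tau>) (\<nu>s \<tau>) \<le> ereal C" if "0 < \<tau>" for \<tau>
      using C that by (simp add: SUP_le_iff)
    \<comment> \<open>The approximation may be -\<infinity>; then \<open>D \<tau>\<close> is
      \<infinity>, because \<open>\<phi>n (n \<tau>) (\<nu>s \<tau>)\<close> is finite.\<close>
    have D_ge: "ereal (x / \<tau>) \<le> D \<tau>"
      if \<tau>: "0 < \<tau>" and x: "moreau_yosida p \<tau> (\<phi>n (n \<tau>)) (\<nu>s \<tau>) + ereal x \<le> \<phi>n (n \<tau>) (\<nu>s \<tau>)" for x \<tau>
    proof -
      obtain f where f: "\<phi>n (n \<tau>) (\<nu>s \<tau>) = ereal f"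
        using \<phi>nC[OF \<tau>] \<phi>n_proper[OF \<nu>s[OF \<tau>], of "n \<tau>"] by (cases "\<phi>n (n \<tau>) (\<nu>s \<tau>)") auto
      show ?thesis
        using x \<tau> unfolding D_def f
        by (cases "moreau_yosida p \<tau> (\<phi>n (n \<tau>)) (\<nu>s \<tau>)") (auto simp: divide_right_mono)
    qed
    show "0 < q" "0 < 1 / q" using conj_exponents by auto
    have "ereal (0 / \<tau>) \<le> D \<tau>" if "0 < \<tau>" for \<tau>
      by (rule D_ge[OF that]) (use moreau_yosida_le_self[OF \<nu>s[OF that]] in \<open>simp add: zero_ereal_def[symmetric]\<close>)
    then show "0 \<le> Liminf (at_right 0) (\<lambda>\<tau>. (\<phi>n (n \<tau>) (\<nu>s \<tau>) - moreau_yosida p \<tau> (\<phi>n (n \<tau>)) (\<nu>s \<tau>)) / ereal \<tau>)"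
      unfolding D_def[symmetric]
      by (intro Liminf_bounded eventually_mono[OF eventually_at_right_less]) (simp add: zero_ereal_def)
    fix c :: real assume c: "0 \<le> c" "ereal c < relaxed_slope p \<phi> \<nu>"
    define K where "K = (p - 1) / p * c powr (p / (p - 1))"
    have K: "0 \<le> K" "K = 1 / q * c powr q" using p by (auto simp: K_def q)
    \<comment> \<open>The level \<open>C + 1\<close> leaves room for the error
      \<open>\<eta>\<close>, at most 1, in the energy of \<open>\<nu>'\<close>.\<close>
    obtain \<delta> where \<delta>: "0 < \<delta>" "\<And>\<sigma>. \<sigma> \<in> P \<Longrightarrow> W \<sigma> \<nu> < \<delta> \<Longrightarrow> \<phi> \<sigma> \<le> ereal (C + 1) \<Longrightarrow> ereal c \<le> local_slope p \<phi> \<sigma>"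
      using local_slope_ge_near[OF c(2), of "C + 1"] by blast
    \<comment> \<open>The lower bound on \<open>pen (a \<tau>)\<close> that
      \<open>descent_near\<close> requires at energy level \<open>C + 1\<close>.\<close>
    define M where "M = (C + 1 + A + B * 2 powr p * (W \<nu> \<mu>star + \<delta>) powr p) / (\<delta> / 2) powr p + B * 2 powr p"
    have pen_a: "filterlim (\<lambda>\<tau>. pen (a \<tau>)) at_top (at_right 0)"
      by (rule filterlim_compose[OF filterlim_pen a_0])
    have ev1: "\<forall>\<^sub>F \<tau> in at_right 0. B * 2 powr p + 1 \<le> pen (a \<tau>)"
      using pen_a by (simp add: filterlim_at_top)
    have ev2: "\<forall>\<^sub>F \<tau> in at_right 0. M < pen (a \<tau>)"
      using pen_a by (simp add: filterlim_at_top_dense)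
    have ev3: "\<forall>\<^sub>F \<tau> in at_right 0. nat \<lceil>max C (W \<nu> \<mu>star + \<delta>)\<rceil> \<le> k \<tau>"
      using k_top unfolding filterlim_at_top by blast
    have ev4: "\<forall>\<^sub>F \<tau> in at_right 0. W (\<nu>s \<tau>) \<nu> < \<delta> / 4"
      using \<delta>(1) by (intro order_tendstoD(2)[OF lim]) auto
    have ev5: "\<forall>\<^sub>F \<tau> in at_right 0. \<tau> \<in> {0<..<min 1 (\<delta> / 4)}"
      using \<delta>(1) by (intro eventually_at_right_real) auto
    \<comment> \<open>The factor \<open>1 / (1 + \<tau>)\<close> is lost in passing from
      \<open>\<tau>\<close> to \<open>a \<tau>\<close>. The term \<open>2 * \<tau>\<close> comes
      from two errors \<open>\<eta>\<close>, one in the energy and one in the approximation, each at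
      most \<open>\<tau> * \<tau>\<close> before division by \<open>\<tau>\<close>.\<close>
    have "\<forall>\<^sub>F \<tau> in at_right 0. ereal (K / (1 + \<tau>) - 2 * \<tau>) \<le> D \<tau>"
      using ev1 ev2 ev3 ev4 ev5
    proof eventually_elim
      fix \<tau> assume pen: "B * 2 powr p + 1 \<le> pen (a \<tau>)" "M < pen (a \<tau>)"
        and k: "nat \<lceil>max C (W \<nu> \<mu>star + \<delta>)\<rceil> \<le> k \<tau>" and near: "W (\<nu>s \<tau>) \<nu> < \<delta> / 4"
        and "\<tau> \<in> {0<..<min 1 (\<delta> / 4)}"
      then have \<tau>: "0 < \<tau>" "\<tau> < 1" "\<tau> < \<delta> / 4" by auto
      define \<eta> where "\<eta> = (a \<tau>)\<^sup>2"
      have "\<eta> \<le> 1 * a \<tau>" unfolding \<eta>_def power2_eq_square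
        using \<alpha>[of "k \<tau>"] by (intro mult_right_mono) (auto simp: a_def)
      then have \<eta>: "\<eta> \<le> a \<tau>" by simp
      have a_le': "a \<tau> \<le> \<tau>" using a_le \<tau> by simp
      have kC: "C \<le> real (k \<tau>)" "W \<nu> \<mu>star + \<delta> \<le> real (k \<tau>)" using k by (simp_all add: nat_le_iff ceiling_le_iff)
      have "N0 (k \<tau>) \<le> (\<Sum>j\<le>k \<tau>. N0 j)" by (rule member_le_sum) auto
      then have "N0 (k \<tau>) \<le> n \<tau>" using n[OF \<tau>(1)] by (simp add: N_def)
      moreover have "B * 2 powr p \<le> pen (\<alpha> (k \<tau>))" using pen(1) by (simp add: a_def)
      moreover have "\<phi>n (n \<tau>) (\<nu>s \<tau>) \<le> ereal (real (k \<tau>))"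
        using \<phi>nC[OF \<tau>(1)] kC(1) by (meson ereal_less_eq(3) order_trans)
      moreover have "W (\<nu>s \<tau>) \<mu>star \<le> real (k \<tau>)"
        using W_triangle[OF \<nu>s[OF \<tau>(1)] \<nu> \<mu>star] near kC(2) \<delta>(1) by linarith
      ultimately obtain \<nu>' where \<nu>': "\<nu>' \<in> P" "W (\<nu>s \<tau>) \<nu>' \<le> \<eta>"
        "\<phi> \<nu>' \<le> \<phi>n (n \<tau>) (\<nu>s \<tau>) + ereal \<eta>"
        "moreau_yosida p (a \<tau>) (\<phi>n (n \<tau>)) (\<nu>s \<tau>) \<le> moreau_yosida p (a \<tau>) \<phi> \<nu>' + ereal \<eta>"
        using N0[of "k \<tau>" "n \<tau>" "\<nu>s \<tau>"] \<nu>s[OF \<tau>(1)] unfolding \<eta>_def a_def by blast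
      \<comment> \<open>One quarter of \<open>\<delta>\<close> is the distance from
        \<open>\<nu>s \<tau>\<close> to \<open>\<nu>\<close>, the other bounds
        \<open>\<eta>\<close>.\<close>
      have near': "W \<nu>' \<nu> \<le> \<delta> / 2"
        using W_triangle[OF \<nu>'(1) \<nu>s[OF \<tau>(1)] \<nu>] W_commute[OF \<nu>'(1) \<nu>s[OF \<tau>(1)]] \<nu>'(2) near \<eta> a_le' \<tau>(3)
        by linarith
      have "\<phi> \<nu>' \<le> ereal C + ereal 1"
        using \<nu>'(3) \<phi>nC[OF \<tau>(1)] \<eta> a_le' \<tau>(2) by (elim order_trans) (intro add_mono, auto)
      then have \<phi>C: "\<phi> \<nu>' \<le> ereal (C + 1)" by simp
      have desc: "moreau_yosida p (a \<tau>) \<phi> \<nu>' + ereal (K * a \<tau>) \<le> \<phi> \<nu>'"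
        unfolding K_def using \<delta> c(1) \<nu> \<nu>'(1) near' \<phi>C a_pos pen(1) pen(2)[unfolded M_def]
        by (rule descent_near)
      \<comment> \<open>A larger scale lowers the approximation, so the estimate at scale
        \<open>a \<tau>\<close> carries over to \<open>\<tau>\<close>.\<close>
      have "moreau_yosida p \<tau> (\<phi>n (n \<tau>)) (\<nu>s \<tau>) \<le> moreau_yosida p (a \<tau>) (\<phi>n (n \<tau>)) (\<nu>s \<tau>)"
        by (rule moreau_yosida_antimono[OF a_pos a_le'])
      also note \<nu>'(4)
      finally have "moreau_yosida p \<tau> (\<phi>n (n \<tau>)) (\<nu>s \<tau>) + ereal (K * a \<tau> - 2 * \<eta>)
          \<le> moreau_yosida p (a \<tau>) \<phi> \<nu>' + ereal \<eta> + ereal (K * a \<tau> - 2 * \<eta>)" by (rule add_right_mono)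
      also have "\<dots> = moreau_yosida p (a \<tau>) \<phi> \<nu>' + ereal (K * a \<tau>) + ereal (- \<eta>)"
        by (cases "moreau_yosida p (a \<tau>) \<phi> \<nu>'") auto
      also have "\<dots> \<le> \<phi> \<nu>' + ereal (- \<eta>)" using desc by (rule add_right_mono)
      also have "\<dots> \<le> \<phi>n (n \<tau>) (\<nu>s \<tau>) + ereal \<eta> + ereal (- \<eta>)" using \<nu>'(3) by (rule add_right_mono)
      also have "\<dots> = \<phi>n (n \<tau>) (\<nu>s \<tau>)" by (cases "\<phi>n (n \<tau>) (\<nu>s \<tau>)") auto
      finally have "ereal ((K * a \<tau> - 2 * \<eta>) / \<tau>) \<le> D \<tau>" by (rule D_ge[OF \<tau>(1)])
      moreover have "K / (1 + \<tau>) - 2 * \<tau> \<le> (K * a \<tau> - 2 * \<eta>) / \<tau>"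
      proof -
        have "K * (\<tau> / (1 + \<tau>)) \<le> K * a \<tau>" using a_ge[OF \<tau>(1)] K(1) by (rule mult_left_mono)
        moreover have "\<eta> \<le> \<tau> * \<tau>"
          unfolding \<eta>_def power2_eq_square using a_le' a_pos[of \<tau>] by (intro mult_mono) auto
        ultimately have "K * (\<tau> / (1 + \<tau>)) - 2 * (\<tau> * \<tau>) \<le> K * a \<tau> - 2 * \<eta>" by linarith
        then have "(K * (\<tau> / (1 + \<tau>)) - 2 * (\<tau> * \<tau>)) / \<tau> \<le> (K * a \<tau> - 2 * \<eta>) / \<tau>"
          using \<tau>(1) by (intro divide_right_mono) auto
        then show ?thesis using \<tau>(1) by (simp add: diff_divide_distrib)
      qed
      ultimately show "ereal (K / (1 + \<tau>) - 2 * \<tau>) \<le> D \<tau>" by (meson ereal_less_eq(3) order_trans)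
    qed
    then have "Liminf (at_right 0) (\<lambda>\<tau>. ereal (K / (1 + \<tau>) - 2 * \<tau>)) \<le> Liminf (at_right 0) D"
      by (rule Liminf_mono)
    moreover have "((\<lambda>\<tau>. ereal (K / (1 + \<tau>) - 2 * \<tau>)) \<longlongrightarrow> ereal (K / (1 + 0) - 2 * 0)) (at_right 0)"
      by (intro tendsto_intros) auto
    then have "Liminf (at_right 0) (\<lambda>\<tau>. ereal (K / (1 + \<tau>) - 2 * \<tau>)) = ereal K"
      by (subst lim_imp_Liminf) auto
    ultimately show "ereal (1 / q * c powr q) \<le>
        Liminf (at_right 0) (\<lambda>\<tau>. (\<phi>n (n \<tau>) (\<nu>s \<tau>) - moreau_yosida p \<tau> (\<phi>n (n \<tau>)) (\<nu>s \<tau>)) / ereal \<tau>)"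
      unfolding K(2)[symmetric] D_def[abs_def, symmetric] by simp
  qed
  show ?thesis
    by (intro exI[of _ N] conjI N_mono N_top allI impI main) auto
qed

end
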